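(* There are infinitely many pairs $(p,q)$ of distinct primes for which $p-q$ is a perfect square, i.e. $p-q=u^2$ for some integer $u\geq 1$. *)

theory Defs
  imports Complex_Main "HOL-Computational_Algebra.Primes"
begin

end

theory Submission imports Defs "HOL-Analysis.Analysis" begin

text \<open>The circle method on the grid of fractions \<open>j / L\<close>. If no two primes beyond some bound differ by a
  nonzero square, then \<open>|S(\<alpha>)|\<^sup>2\<close>, for \<open>S(\<alpha>)\<close> the exponential sum over the primes \<open>p \<le> N\<close>, is orthogonal to
  the mean \<open>T(\<alpha>)\<close> of \<open>cos (2 \<pi> Q\<^sup>2 v\<^sup>2 \<alpha>)\<close> over \<open>v \<le> V\<close> whenever \<open>Q V \<le> \<surd>N\<close>. Near \<open>\<alpha> = 0\<close> both are large, which by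
  Chebyshev's bound yields a contribution of order \<open>1 / ln N\<close> relative to the total mass of \<open>|S|\<^sup>2\<close>.
  By Weyl differencing without logarithmic losses, \<open>T(\<alpha>) \<le> -t\<close> forces \<open>Q\<^sup>2 \<alpha>\<close> to be close to a fraction with
  denominator \<open>O(t\<^sup>-\<^sup>2)\<close>. Since the primes are sieved, shifting such points by fractions with coprime denominators
  shows that the set where this happens carries only a proportion \<open>O(t\<^sup>-\<^sup>2\<^sup>/\<^sup>3 / ln N)\<close> of the mass, so that dyadic
  summation over small \<open>t\<close> is harmless. For \<open>t\<close> bounded below one averages over a sequence of
  scales \<open>(Q, V)\<close>, each \<open>Q\<close> very divisible compared with the previous one: if \<open>T\<close> is quite negative at \<open>\<alpha>\<close> for one
  scale, then \<open>Q\<^sup>2 \<alpha>\<close> is so close to an integer at all later scales that \<open>T\<close> is nonnegative there. No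
  distribution of primes in progressions is needed.\<close>

section \<open>Prime number estimates\<close>

text \<open>The induction is the recursion of the Leibniz harmonic triangle: the reciprocal of
  \<open>m * (n choose m)\<close> is the difference of two reciprocals of the row and column before it.\<close>

lemma Suc_mult_binomial_dvd:
  fixes d :: nat
  assumes d: "\<And>k. 1 \<le> k \<Longrightarrow> k \<le> N \<Longrightarrow> k dvd d"
  shows "m < n \<Longrightarrow> n \<le> N \<Longrightarrow> Suc m * (n choose Suc m) dvd d"
proof (induction m arbitrary: n)
  case 0
  then show ?case using d[of n] by simp
next
  case (Suc m)
  obtain x where x: "d = Suc m * ((n - 1) choose Suc m) * x"
    using Suc.IH[of "n - 1"] Suc.prems unfolding dvd_def by fastforce
  obtain y where y: "d = Suc m * (n choose Suc m) * y"
    using Suc.IH[of n] Suc.prems unfolding dvd_def by fastforce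
  define G where "G = n * ((n - 1) choose Suc m)"
  have G1: "Suc (Suc m) * (n choose Suc (Suc m)) = G"
    unfolding G_def by (rule binomial_absorption)
  have G2: "(n - Suc m) * (n choose Suc m) = G"
    unfolding G_def by (rule binomial_absorb_comp)
  \<comment> \<open>Both induction hypotheses express a multiple of \<open>d\<close> through
    \<open>G\<close>. As \<open>n - (n - Suc m) = Suc m\<close>, subtracting them leaves
    \<open>d\<close> as an integer multiple of \<open>G\<close>.\<close>
  have "int G * int x * int (Suc m) = int n * int d"
    by (subst x, simp only: G_def of_nat_mult mult_ac)
  moreover have "int G * int y * int (Suc m) = int (n - Suc m) * int d"
    by (subst y, simp only: G2[symmetric] of_nat_mult mult_ac)
  moreover have "int (n - Suc m) = int n - int (Suc m)" using Suc.prems by auto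
  ultimately have "int (Suc m) * (int G * (int x - int y)) = int (Suc m) * int d"
    by (simp only: algebra_simps)
  then have "int G * (int x - int y) = int d" by (simp del: of_nat_Suc)
  then have "int G dvd int d" by (metis dvd_triv_left)
  then show ?case using G1 by simp
qed

text \<open>The product \<open>d\<close> of the maximal prime powers up to \<open>2 * n\<close> is
  squeezed: every \<open>k \<le> 2 * n\<close> divides it, so \<open>n * (2 * n choose n)\<close>,
  which is at least \<open>4 ^ n / 2\<close>, divides it as well, while each of its prime powers is
  at most \<open>2 * n\<close>.\<close>

lemma chebyshev_lower:
  assumes "n \<ge> 1"
  shows "real n * ln 4 - ln 2 \<le> real (card {p. prime p \<and> p \<le> 2 * n}) * ln (real (2 * n))"
proof -
  define P where "P = {p. prime p \<and> p \<le> 2 * n}"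
  have fin: "finite P" unfolding P_def by simp
  have "\<exists>e. p ^ e \<le> 2 * n \<and> 2 * n < p ^ (e + 1)" if "p \<in> P" for p
    using ex_power_ivl1[of p "2 * n"] that assms prime_ge_2_nat by (auto simp: P_def)
  then obtain e where e: "\<And>p. p \<in> P \<Longrightarrow> p ^ e p \<le> 2 * n" "\<And>p. p \<in> P \<Longrightarrow> 2 * n < p ^ (e p + 1)"
    by metis
  define d where "d = (\<Prod>p\<in>P. p ^ e p)"
  have dk: "k dvd d" if k: "1 \<le> k" "k \<le> 2 * n" for k
  proof -
    have sub: "prime_factors k \<subseteq> P"
    proof
      fix p assume p: "p \<in> prime_factors k"
      then have "p \<le> k" using k by (intro dvd_imp_le) auto
      then show "p \<in> P" using p k by (auto simp: P_def)
    qed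
    have "k = (\<Prod>p\<in>prime_factors k. p ^ multiplicity p k)"
      using k by (intro prime_factorization_nat) auto
    also have "\<dots> dvd (\<Prod>p\<in>prime_factors k. p ^ e p)"
    proof (rule prod_dvd_prod)
      fix p assume p: "p \<in> prime_factors k"
      then have pP: "p \<in> P" and p1: "p > 1" using sub prime_gt_1_nat by (auto simp: P_def)
      have "p ^ multiplicity p k \<le> k" using multiplicity_dvd[of p k] k by (auto dest: dvd_imp_le)
      then have "p ^ multiplicity p k < p ^ (e p + 1)" using k e(2)[OF pP] by linarith
      then have "multiplicity p k \<le> e p" using p1 power_less_imp_less_exp[of p "multiplicity p k" "e p + 1"] by simp
      then show "p ^ multiplicity p k dvd p ^ e p" by (rule le_imp_power_dvd)
    qed
    also have "\<dots> dvd d" unfolding d_def using sub fin by (rule prod_dvd_prod_subset[rotated])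
    finally show ?thesis .
  qed
  have dpos: "d > 0" unfolding d_def by (intro prod_pos) (auto simp: P_def prime_gt_0_nat)
  have "Suc (n - 1) * (2 * n choose Suc (n - 1)) dvd d"
    using assms by (intro Suc_mult_binomial_dvd[of "2 * n"] dk) auto
  then have 1: "n * (2 * n choose n) \<le> d" using dpos assms by (auto dest: dvd_imp_le)
  have "d \<le> (\<Prod>p\<in>P. 2 * n)" unfolding d_def by (intro prod_mono) (auto simp: e)
  then have 2: "d \<le> (2 * n) ^ card P" by simp
  have "4 ^ n / (2 * real n) \<le> real (2 * n choose n)"
    using central_binomial_lower_bound[of n] assms by simp
  then have "4 ^ n / 2 \<le> real n * real (2 * n choose n)" using assms by (simp add: field_simps)
  also have "\<dots> = real (n * (2 * n choose n))" by simp
  also have "\<dots> \<le> real ((2 * n) ^ card P)" using 1 2 by (intro of_nat_mono) linarith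
  finally have "4 ^ n / 2 \<le> real (2 * n) ^ card P" by simp
  then have "ln (4 ^ n / 2) \<le> ln (real (2 * n) ^ card P)" using assms by (subst ln_le_cancel_iff) auto
  then have "real n * ln 4 - ln 2 \<le> real (card P) * ln (real (2 * n))"
    using assms by (simp add: ln_div ln_realpow del: of_nat_mult)
  then show ?thesis unfolding P_def .
qed

text \<open>The factors are \<open>p / (p - 1)\<close> at \<open>p = 6 * j - 1\<close> and
  \<open>p = 6 * j + 1\<close>. Their product is about \<open>1 + 1 / (3 * j)\<close>, so its cube
  can be compared with the telescoping ratio \<open>(3 * j + 1) / (3 * j - 2)\<close>.\<close>

lemma prod_mod_6_cube_le:
  "(\<Prod>j=1..J. (6 * real j - 1) / (6 * real j - 2) * ((6 * real j + 1) / (6 * real j))) ^ 3 \<le> 3 * real J + 1"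
proof -
  define f where "f = (\<lambda>j. (6 * real j - 1) / (6 * real j - 2) * ((6 * real j + 1) / (6 * real j)))"
  have step: "f (Suc J) ^ 3 * (3 * real J + 1) \<le> 3 * real (Suc J) + 1" for J
  proof -
    define i where "i = real J"
    have i: "i \<ge> 0" by (simp add: i_def)
    have fe: "f (Suc J) = ((6*i+5) * (6*i+7)) / ((6*i+4) * (6*i+6))" by (simp add: f_def i_def algebra_simps)
    have *: "(a / b) ^ 3 * c \<le> d" if "a ^ 3 * c \<le> d * b ^ 3" "b > 0" for a b c d :: real
      using that by (simp add: power_divide pos_divide_le_eq)
    have "((6*i+5) * (6*i+7)) ^ 3 * (3 * i + 1) \<le> (3 * i + 4) * ((6*i+4) * (6*i+6)) ^ 3"
      using i by (simp add: power3_eq_cube algebra_simps)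
    then have "f (Suc J) ^ 3 * (3 * i + 1) \<le> 3 * i + 4"
      unfolding fe by (rule *) (use i in \<open>auto intro!: mult_pos_pos\<close>)
    then show ?thesis by (simp add: i_def)
  qed
  have f0: "f (Suc J) \<ge> 0" for J by (simp add: f_def)
  have "(\<Prod>j=1..J. f j) ^ 3 \<le> 3 * real J + 1"
  proof (induction J)
    case (Suc J)
    have "(\<Prod>j=1..Suc J. f j) ^ 3 = f (Suc J) ^ 3 * (\<Prod>j=1..J. f j) ^ 3"
      by (simp add: power_mult_distrib)
    also have "\<dots> \<le> f (Suc J) ^ 3 * (3 * real J + 1)"
      by (intro mult_left_mono Suc.IH zero_le_power f0)
    also have "\<dots> \<le> 3 * real (Suc J) + 1" by (rule step)
    finally show ?case .
  qed simp
  then show ?thesis by (simp add: f_def)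
qed

lemma prime_mod_6:
  fixes p :: nat
  assumes "prime p" "p \<noteq> 2" "p \<noteq> 3"
  obtains j where "j \<ge> 1" "p = 6 * j - 1 \<or> p = 6 * j + 1"
proof -
  have "\<not> 2 dvd p" "\<not> 3 dvd p"
    using assms primes_dvd_imp_eq[of 2 p] primes_dvd_imp_eq[of 3 p] by auto
  then have "p mod 6 = 1 \<or> p mod 6 = 5" by presburger
  moreover have "p > 1" using assms prime_gt_1_nat by blast
  ultimately have "p div 6 \<ge> 1 \<and> p = 6 * (p div 6) + 1 \<or> p = 6 * (p div 6 + 1) - 1" by presburger
  then show ?thesis using that[of "p div 6"] that[of "p div 6 + 1"] by auto
qed

text \<open>Mertens' theorem gives \<open>O(ln y)\<close>. Any bound by a power of \<open>y ^ 3\<close> with exponent below \<open>1 / 2\<close> is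
  good enough here, and \<open>1 / 3\<close> is the density of the classes \<open>\<plusminus>1\<close> modulo \<open>6\<close>.\<close>

lemma mertens_upper:
  assumes "y \<ge> 1"
  shows "(\<Prod>p | prime p \<and> p \<le> y ^ 3. real p / (real p - 1)) \<le> 4 * real y"
proof -
  \<comment> \<open>The largest \<open>j\<close> with \<open>6 * j - 1 \<le> y ^ 3\<close>.\<close>
  define J where "J = (y ^ 3 + 1) div 6"
  define f where "f = (\<lambda>p::nat. real p / (real p - 1))"
  define A where "A = (\<lambda>j. 6 * j - 1) ` {1..J}"
  define B where "B = (\<lambda>j. 6 * j + 1) ` {1..J}"
  have sub: "{p. prime p \<and> p \<le> y ^ 3} \<subseteq> {2, 3} \<union> A \<union> B"
  proof
    fix p assume p: "p \<in> {p. prime p \<and> p \<le> y ^ 3}"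
    show "p \<in> {2, 3} \<union> A \<union> B"
    proof (cases "p = 2 \<or> p = 3")
      case False
      then obtain j where j: "j \<ge> 1" "p = 6 * j - 1 \<or> p = 6 * j + 1"
        using prime_mod_6[of p] p by auto
      then have "j \<in> {1..J}" using p unfolding J_def by auto
      then show ?thesis using j unfolding A_def B_def by blast
    qed auto
  qed
  have f1: "f p \<ge> 1" if "p \<in> {2, 3} \<union> A \<union> B" for p
  proof -
    have "p > 1" using that by (auto simp: A_def B_def)
    then show ?thesis by (simp add: f_def)
  qed
  have fA: "prod f A = (\<Prod>j=1..J. (6 * real j - 1) / (6 * real j - 2))"
    unfolding A_def by (subst prod.reindex) (auto simp: inj_on_def f_def of_nat_diff intro!: prod.cong)
  have fB: "prod f B = (\<Prod>j=1..J. (6 * real j + 1) / (6 * real j))"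
    unfolding B_def by (subst prod.reindex) (auto simp: inj_on_def f_def intro!: prod.cong)
  have "prod f {p. prime p \<and> p \<le> y ^ 3} \<le> prod f ({2, 3} \<union> A \<union> B)"
  proof (rule prod_mono2)
    show "finite ({2, 3} \<union> A \<union> B)" by (simp add: A_def B_def)
    show "0 \<le> f p" if "p \<in> {p. prime p \<and> p \<le> y ^ 3}" for p
      using f1[of p] sub that by (meson order_trans subsetD zero_le_one)
  qed (use sub f1 in auto)
  also have "\<dots> = prod f {2, 3} * (prod f A * prod f B)"
  proof -
    have "x mod 6 = 5" if x: "x \<in> A" for x
    proof -
      obtain j where "j \<ge> 1" "x = 6 * j - 1" using x by (auto simp: A_def)
      then have "x = 6 * (j - 1) + 5" by simp
      then show ?thesis by simp
    qed
    moreover have "x mod 6 = 1" if "x \<in> B" for x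
      using that by (auto simp: B_def)
    ultimately have "2 \<notin> A" "3 \<notin> A" "2 \<notin> B" "3 \<notin> B" "A \<inter> B = {}" by force+
    then have "{2, 3} \<inter> A = {}" "({2, 3} \<union> A) \<inter> B = {}" by auto
    then show ?thesis by (simp add: prod.union_disjoint A_def B_def)
  qed
  \<comment> \<open>The primes 2 and 3 contribute \<open>2 * (3 / 2) = 3\<close>.\<close>
  also have "\<dots> = 3 * (\<Prod>j=1..J. (6 * real j - 1) / (6 * real j - 2) * ((6 * real j + 1) / (6 * real j)))"
    unfolding fA fB prod.distrib[symmetric] by (simp add: f_def)
  finally have le: "prod f {p. prime p \<and> p \<le> y ^ 3} \<le> 3 * (\<Prod>j=1..J. (6 * real j - 1) / (6 * real j - 2) * ((6 * real j + 1) / (6 * real j)))" (is "_ \<le> 3 * ?Q") .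
  have J: "real J \<le> (real y ^ 3 + 1) / 6"
  proof -
    have "real (6 * J) \<le> real (y ^ 3 + 1)" unfolding J_def by (intro of_nat_mono) simp
    then show ?thesis by simp
  qed
  have "(3 * ?Q) ^ 3 \<le> 27 * (3 * real J + 1)" using prod_mod_6_cube_le[of J] by (simp add: power_mult_distrib)
  also have "\<dots> \<le> 27 * (3 * ((real y ^ 3 + 1) / 6) + 1)" using J by simp
  \<comment> \<open>The left side is \<open>13.5 * y ^ 3 + 40.5\<close>, at most
    \<open>54 * y ^ 3\<close> because \<open>y \<ge> 1\<close>.\<close>
  also have "27 * (3 * ((real y ^ 3 + 1) / 6) + 1) \<le> (4 * real y) ^ 3"
  proof -
    have "1 \<le> real y ^ 3" using assms by (intro one_le_power) simp
    then show ?thesis by (simp add: power_mult_distrib field_simps)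
  qed
  finally have "(3 * ?Q) ^ Suc (Suc (Suc 0)) \<le> (4 * real y) ^ Suc (Suc (Suc 0))"
    by (simp only: numeral_3_eq_3)
  then have "3 * ?Q \<le> 4 * real y" by (rule power_le_imp_le_base) simp
  then show ?thesis using le unfolding f_def by linarith
qed

text \<open>A set \<open>X\<close> of primes stands for the squarefree number
  \<open>\<Prod>X\<close>, with weight \<open>1 / phi(\<Prod>X)\<close>. Grouping the harmonic sum
  up to \<open>R\<close> by the set of prime factors outside \<open>Z\<close>, each group is bounded
  by an Euler product: exponents start at 0 on \<open>Z\<close> and at 1 on \<open>X\<close>. These
  weights are exactly those lost when an exponential sum is shifted by fractions with denominator
  \<open>\<Prod>X\<close>.\<close>

lemma sum_prime_products_ge:
  fixes Z :: "nat set" and R :: nat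
  assumes Z: "finite Z" "\<And>p. p \<in> Z \<Longrightarrow> prime p"
  shows "ln (real R + 1) \<le> (\<Prod>p\<in>Z. real p / (real p - 1)) *
     (\<Sum>X | X \<subseteq> {p. prime p \<and> p \<le> R} - Z \<and> \<Prod>X \<le> R. \<Prod>p\<in>X. 1 / (real p - 1))"
proof -
  define XX where "XX = {X. X \<subseteq> {p. prime p \<and> p \<le> R} - Z \<and> \<Prod>X \<le> R}"
  have finXX: "finite XX" unfolding XX_def
    by (rule finite_subset[of _ "Pow {p. p \<le> R}"]) auto
  define h where "h = (\<lambda>n. prime_factors n - Z)"
  have himg: "h ` {1..R} \<subseteq> XX"
  proof (rule image_subsetI)
    fix n assume n: "n \<in> {1..R}"
    have "\<Prod>(h n) dvd \<Prod>(prime_factors n)" unfolding h_def by (intro prod_dvd_prod_subset) auto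
    also have "\<dots> dvd (\<Prod>p\<in>prime_factors n. p ^ multiplicity p n)"
      by (intro prod_dvd_prod dvd_power) (auto simp: prime_factors_multiplicity)
    also have "\<dots> = n" using n by (intro prime_factorization_nat[symmetric]) auto
    finally have "\<Prod>(h n) \<le> R" using n by (auto dest: dvd_imp_le)
    moreover have "h n \<subseteq> {p. prime p \<and> p \<le> R} - Z"
      using n by (auto simp: h_def in_prime_factors_iff dest!: dvd_imp_le)
    ultimately show "h n \<in> XX" by (simp add: XX_def)
  qed
  have part: "(\<Sum>n | n \<in> {1..R} \<and> h n = X. 1 / real n) \<le>
      (\<Prod>p\<in>Z. real p / (real p - 1)) * (\<Prod>p\<in>X. 1 / (real p - 1))" if X: "X \<in> XX" for X
  proof -
    have finX: "finite X" using X by (auto simp: XX_def intro: finite_subset[of _ "{..R}"])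
    have prX: "prime p" if "p \<in> X" for p using X that by (auto simp: XX_def)
    have disj: "Z \<inter> X = {}" using X by (auto simp: XX_def)
    define A where "A = {n. n \<in> {1..R} \<and> h n = X}"
    \<comment> \<open>The exponent vector of \<open>n\<close> on \<open>Z \<union> X\<close>
      determines \<open>n\<close> within the group, and all exponents are at most \<open>R\<close>,
      so the group embeds into a finite product of ranges.\<close>
    define g where "g = (\<lambda>n. restrict (\<lambda>p. multiplicity p n) (Z \<union> X))"
    define C where "C = (\<lambda>p. if p \<in> X then {1..R} else {0..R})"
    have nA: "n = (\<Prod>p\<in>Z \<union> X. p ^ multiplicity p n)" if "n \<in> A" for n
    proof -
      have "n = (\<Prod>p\<in>prime_factors n. p ^ multiplicity p n)"
        using that by (intro prime_factorization_nat) (auto simp: A_def)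
      also have "\<dots> = (\<Prod>p\<in>Z \<union> X. p ^ multiplicity p n)"
        using that Z prX finX
        by (intro prod.mono_neutral_left) (auto simp: A_def h_def prime_factors_multiplicity)
      finally show ?thesis .
    qed
    have inj: "inj_on g A"
    proof (rule inj_onI)
      fix m n assume mn: "m \<in> A" "n \<in> A" "g m = g n"
      have "multiplicity p m = multiplicity p n" if "p \<in> Z \<union> X" for p
        using fun_cong[OF mn(3), of p] that by (auto simp: g_def)
      then have "(\<Prod>p\<in>Z \<union> X. p ^ multiplicity p m) = (\<Prod>p\<in>Z \<union> X. p ^ multiplicity p n)"
        by (intro prod.cong) auto
      then show "m = n" using nA mn by metis
    qed
    have img: "g ` A \<subseteq> PiE (Z \<union> X) C"
    proof (rule image_subsetI)
      fix n assume n: "n \<in> A"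
      have "multiplicity p n \<in> C p" if p: "p \<in> Z \<union> X" for p
      proof -
        have pp: "prime p" using p Z prX by auto
        have "multiplicity p n < p ^ multiplicity p n" using pp prime_gt_1_nat by (simp add: power_gt_expt)
        also have "\<dots> \<le> n" using multiplicity_dvd[of p n] n by (auto simp: A_def dest: dvd_imp_le)
        finally have "multiplicity p n \<le> R" using n by (auto simp: A_def)
        moreover have "multiplicity p n > 0" if "p \<in> X"
        proof -
          have "p \<in> prime_factors n" using that n by (auto simp: A_def h_def)
          then show ?thesis by (simp add: prime_factors_multiplicity)
        qed
        ultimately show ?thesis by (auto simp: C_def Suc_le_eq)
      qed
      then show "g n \<in> PiE (Z \<union> X) C" unfolding g_def by auto
    qed
    have "(\<Sum>n\<in>A. 1 / real n) = (\<Sum>n\<in>A. \<Prod>p\<in>Z \<union> X. 1 / real p ^ g n p)"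
    proof (rule sum.cong)
      fix n assume n: "n \<in> A"
      have "1 / real n = 1 / real (\<Prod>p\<in>Z \<union> X. p ^ multiplicity p n)" using nA[OF n] by simp
      also have "\<dots> = (\<Prod>p\<in>Z \<union> X. 1 / real p ^ multiplicity p n)" by (simp add: prod_dividef)
      also have "\<dots> = (\<Prod>p\<in>Z \<union> X. 1 / real p ^ g n p)" by (intro prod.cong) (auto simp: g_def)
      finally show "1 / real n = (\<Prod>p\<in>Z \<union> X. 1 / real p ^ g n p)" .
    qed simp
    also have "\<dots> = (\<Sum>k\<in>g ` A. \<Prod>p\<in>Z \<union> X. 1 / real p ^ k p)"
      by (subst sum.reindex[OF inj]) simp
    also have "\<dots> \<le> (\<Sum>k\<in>PiE (Z \<union> X) C. \<Prod>p\<in>Z \<union> X. 1 / real p ^ k p)"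
      using img Z finX by (intro sum_mono2 finite_PiE) (auto simp: C_def intro!: prod_nonneg)
    also have "\<dots> = (\<Prod>p\<in>Z \<union> X. \<Sum>k\<in>C p. 1 / real p ^ k)"
      using Z finX by (intro prod_sum_PiE[symmetric]) (auto simp: C_def)
    also have "\<dots> \<le> (\<Prod>p\<in>Z \<union> X. if p \<in> X then 1 / (real p - 1) else real p / (real p - 1))"
    proof (intro prod_mono conjI)
      fix p assume p: "p \<in> Z \<union> X"
      then have "prime p" using Z prX by auto
      then have p1: "real p > 1" using prime_gt_1_nat by simp
      show "0 \<le> (\<Sum>k\<in>C p. 1 / real p ^ k)" by (intro sum_nonneg) simp
      have s: "(\<Sum>k<n. (1 / real p) ^ k) \<le> real p / (real p - 1)" for n
      proof -
        have "(\<Sum>k<n. (1 / real p) ^ k) \<le> (\<Sum>k. (1 / real p) ^ k)"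
          using p1 by (intro sum_le_suminf summable_geometric) auto
        also have "\<dots> = real p / (real p - 1)" using p1 by (subst suminf_geometric) (auto simp: field_simps)
        finally show ?thesis .
      qed
      have s0: "(\<Sum>k=0..R. 1 / real p ^ k) \<le> real p / (real p - 1)"
        using s[of "Suc R"] by (simp add: power_one_over atLeast0AtMost lessThan_Suc_atMost)
      have "(\<Sum>k=0..R. 1 / real p ^ k) = 1 + (\<Sum>k=1..R. 1 / real p ^ k)"
        by (subst sum.atLeast_Suc_atMost) auto
      \<comment> \<open>Dropping the exponent 0 removes 1 from \<open>p / (p - 1)\<close>.\<close>
      then have s1: "(\<Sum>k=1..R. 1 / real p ^ k) \<le> 1 / (real p - 1)"
        using s0 p1 by (simp add: field_simps)
      show "(\<Sum>k\<in>C p. 1 / real p ^ k) \<le> (if p \<in> X then 1 / (real p - 1) else real p / (real p - 1))"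
        using s0 s1 by (auto simp: C_def)
    qed
    also have "\<dots> = (\<Prod>p\<in>Z. if p \<in> X then 1 / (real p - 1) else real p / (real p - 1)) *
         (\<Prod>p\<in>X. if p \<in> X then 1 / (real p - 1) else real p / (real p - 1))"
      using Z finX disj by (intro prod.union_disjoint) auto
    also have "\<dots> = (\<Prod>p\<in>Z. real p / (real p - 1)) * (\<Prod>p\<in>X. 1 / (real p - 1))"
      using disj by (intro arg_cong2[where f="(*)"] prod.cong) auto
    finally show ?thesis by (simp add: A_def)
  qed
  have "ln (real R + 1) \<le> (\<Sum>n\<in>{1..R}. 1 / real n)"
    using ln_le_harm[of R] by (simp add: harm_def inverse_eq_divide)
  also have "\<dots> = (\<Sum>X\<in>XX. \<Sum>n | n \<in> {1..R} \<and> h n = X. 1 / real n)"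
    by (rule sum.group[symmetric]) (use finXX himg in auto)
  also have "\<dots> \<le> (\<Sum>X\<in>XX. (\<Prod>p\<in>Z. real p / (real p - 1)) * (\<Prod>p\<in>X. 1 / (real p - 1)))"
    by (intro sum_mono part)
  also have "\<dots> = (\<Prod>p\<in>Z. real p / (real p - 1)) * (\<Sum>X\<in>XX. \<Prod>p\<in>X. 1 / (real p - 1))"
    by (simp add: sum_distrib_left)
  finally show ?thesis unfolding XX_def .
qed

section \<open>Mass of a prime exponential sum near fractions\<close>

definition unit_exp :: "real \<Rightarrow> complex" where
  "unit_exp x = cis (2 * pi * x)"

lemma norm_unit_exp [simp]: "cmod (unit_exp x) = 1"
  by (simp add: unit_exp_def)

lemma unit_exp_0 [simp]: "unit_exp 0 = 1"
  by (simp add: unit_exp_def)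

lemma unit_exp_add: "unit_exp (x + y) = unit_exp x * unit_exp y"
  by (simp add: unit_exp_def cis_mult algebra_simps)

lemma unit_exp_of_int [simp]: "unit_exp (of_int n) = 1"
  by (simp add: unit_exp_def complex_eq_iff cos_int_2pin sin_int_2pin)

lemma unit_exp_add_of_int [simp]: "unit_exp (x + of_int n) = unit_exp x"
  by (simp add: unit_exp_add)

lemma cnj_unit_exp: "cnj (unit_exp x) = unit_exp (- x)"
  by (simp add: unit_exp_def cis_cnj)

lemma unit_exp_sum: "unit_exp (sum f A) = (\<Prod>x\<in>A. unit_exp (f x))"
  by (induction A rule: infinite_finite_induct) (auto simp: unit_exp_add)

lemma unit_exp_power: "unit_exp (real n * x) = unit_exp x ^ n"
  by (induction n) (auto simp: unit_exp_add algebra_simps)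

lemma Re_unit_exp: "Re (unit_exp x) = cos (2 * pi * x)"
  by (simp add: unit_exp_def)

lemma unit_exp_eq_1_iff: "unit_exp x = 1 \<longleftrightarrow> x \<in> \<int>"
proof
  assume "unit_exp x = 1"
  then have "cos (2 * pi * x) = 1" by (metis Re_unit_exp one_complex.simps(1))
  then obtain k :: int where "2 * pi * x = k * 2 * pi" by (auto simp: cos_one_2pi_int)
  then have "x = of_int k" by simp
  then show "x \<in> \<int>" by simp
qed (auto elim: Ints_cases)

lemma of_int_div_in_Ints_iff:
  assumes "L > 0"
  shows "of_int h / real L \<in> \<int> \<longleftrightarrow> int L dvd h"
proof
  assume "of_int h / real L \<in> \<int>"
  then obtain k where "of_int h / real L = of_int k" by (auto elim: Ints_cases)
  then have "real_of_int h = of_int (int L * k)" using assms by (simp add: field_simps)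
  then show "int L dvd h" by (simp only: of_int_eq_iff dvd_triv_left)
next
  assume "int L dvd h"
  then show "of_int h / real L \<in> \<int>" using assms by (auto simp: dvd_def)
qed

section \<open>Orthogonality and second moments on the grid of fractions\<close>

lemma sum_unit_exp_lessThan:
  assumes "L > 0"
  shows "(\<Sum>j<L. unit_exp (of_int h * (real j / real L))) = (if int L dvd h then of_nat L else 0)"
proof -
  let ?x = "unit_exp (of_int h / real L)"
  have eq: "unit_exp (of_int h * (real j / real L)) = ?x ^ j" for j
    by (simp flip: unit_exp_power add: mult_ac)
  show ?thesis
  proof (cases "int L dvd h")
    case True
    then have "?x = 1" using of_int_div_in_Ints_iff[OF assms] by (simp add: unit_exp_eq_1_iff)
    then show ?thesis using True unfolding eq by simp
  next
    case False
    then have "?x \<noteq> 1" using of_int_div_in_Ints_iff[OF assms] by (simp add: unit_exp_eq_1_iff)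
    moreover have "?x ^ L = unit_exp (of_int h)" using assms by (simp flip: unit_exp_power)
    ultimately show ?thesis using False unfolding eq by (simp add: geometric_sum)
  qed
qed

text \<open>Sampling at the grid points \<open>j / L\<close> replaces integration over the circle by
  finite sums. Orthogonality stays exact as long as the frequencies involved are below
  \<open>L\<close> in absolute value.\<close>

definition exp_sum :: "nat set \<Rightarrow> nat \<Rightarrow> nat \<Rightarrow> complex" where
  "exp_sum P L j = (\<Sum>p\<in>P. unit_exp (real p * (real j / real L)))"

lemma cmod_exp_sum_squared:
  "complex_of_real ((cmod (exp_sum P L j))\<^sup>2) =
     (\<Sum>p\<in>P. \<Sum>q\<in>P. unit_exp (of_int (int p - int q) * (real j / real L)))"
  unfolding complex_norm_square exp_sum_def cnj_sum sum_product
  by (intro sum.cong refl) (simp add: cnj_unit_exp unit_exp_add[symmetric] algebra_simps diff_divide_distrib)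

lemma sum_cmod_exp_sum_squared_mult:
  assumes "L > 0"
  shows "(\<Sum>j<L. complex_of_real ((cmod (exp_sum P L j))\<^sup>2) * unit_exp (of_int k * (real j / real L))) =
     (\<Sum>p\<in>P. \<Sum>q\<in>P. if int L dvd int p - int q + k then of_nat L else 0)"
proof -
  have "(\<Sum>j<L. complex_of_real ((cmod (exp_sum P L j))\<^sup>2) * unit_exp (of_int k * (real j / real L))) =
     (\<Sum>j<L. \<Sum>p\<in>P. \<Sum>q\<in>P. unit_exp (of_int (int p - int q + k) * (real j / real L)))"
    unfolding cmod_exp_sum_squared sum_distrib_right
    by (intro sum.cong refl) (simp add: unit_exp_add[symmetric] algebra_simps add_divide_distrib diff_divide_distrib)
  also have "\<dots> = (\<Sum>p\<in>P. \<Sum>q\<in>P. \<Sum>j<L. unit_exp (of_int (int p - int q + k) * (real j / real L)))"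
    by (subst sum.swap, intro sum.cong refl sum.swap)
  also have "\<dots> = (\<Sum>p\<in>P. \<Sum>q\<in>P. if int L dvd int p - int q + k then of_nat L else 0)"
    by (intro sum.cong refl sum_unit_exp_lessThan assms)
  finally show ?thesis .
qed

lemma sum_cmod_exp_sum_squared:
  assumes "L > 0" "finite P" "P \<subseteq> {..<L}"
  shows "(\<Sum>j<L. (cmod (exp_sum P L j))\<^sup>2) = real L * real (card P)"
proof -
  have *: "int L dvd int p - int q \<longleftrightarrow> p = q" if "p \<in> P" "q \<in> P" for p q
  proof
    assume d: "int L dvd int p - int q"
    have "\<bar>int p - int q\<bar> < int L" using subsetD[OF assms(3) that(1)] subsetD[OF assms(3) that(2)] by auto
    then show "p = q" using zdvd_not_zless[of "\<bar>int p - int q\<bar>" "int L"] d by auto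
  qed simp
  have "complex_of_real (\<Sum>j<L. (cmod (exp_sum P L j))\<^sup>2) =
     (\<Sum>p\<in>P. \<Sum>q\<in>P. if int L dvd int p - int q + 0 then of_nat L else 0)"
    using sum_cmod_exp_sum_squared_mult[OF assms(1), of P 0] by simp
  also have "\<dots> = (\<Sum>p\<in>P. \<Sum>q\<in>P. if p = q then of_nat L else 0)"
    using * by (intro sum.cong refl) auto
  also have "\<dots> = complex_of_real (real L * real (card P))"
    using assms(2) by simp
  finally show ?thesis by (simp only: of_real_eq_iff)
qed

text \<open>Expanding the square, the sum counts the pairs with \<open>p - q + k\<close> divisible
  by \<open>L\<close>. This is where the absence of square differences enters, with \<open>k\<close>
  a square.\<close>

lemma sum_cmod_exp_sum_squared_cos_eq_0:
  assumes "L > 0" "\<And>p q. p \<in> P \<Longrightarrow> q \<in> P \<Longrightarrow> \<not> int L dvd int p - int q + k"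
  shows "(\<Sum>j<L. (cmod (exp_sum P L j))\<^sup>2 * cos (2 * pi * (of_int k * (real j / real L)))) = 0"
proof -
  have "Re (\<Sum>j<L. complex_of_real ((cmod (exp_sum P L j))\<^sup>2) * unit_exp (of_int k * (real j / real L))) = 0"
    unfolding sum_cmod_exp_sum_squared_mult[OF assms(1)] using assms(2) by simp
  then show ?thesis by (simp add: Re_unit_exp)
qed

lemma exp_sum_cong_mod:
  assumes "L > 0"
  shows "exp_sum P L (j mod L) = exp_sum P L j"
  unfolding exp_sum_def
proof (intro sum.cong refl)
  fix p
  have "real j = real (j mod L) + real L * real (j div L)"
    by (metis mod_mult_div_eq of_nat_add of_nat_mult)
  then have "real p * (real j / real L) = real p * (real (j mod L) / real L) + of_int (int (p * (j div L)))"
    using assms by (simp add: field_simps)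
  then show "unit_exp (real p * (real (j mod L) / real L)) = unit_exp (real p * (real j / real L))"
    by (simp only: unit_exp_add_of_int)
qed

section \<open>Shifts by fractions with squarefree denominator\<close>

lemma sum_unit_exp_prime:
  assumes "prime p" "\<not> p dvd q"
  shows "(\<Sum>b\<in>{1..<p}. unit_exp (real q * (real b / real p))) = -1"
proof -
  have p: "p > 0" using assms prime_gt_0_nat by blast
  have "(\<Sum>b<p. unit_exp (real q * (real b / real p))) = 0"
    using sum_unit_exp_lessThan[OF p, of "int q"] assms by simp
  moreover have "{..<p} = insert 0 {1..<p}" using p by auto
  ultimately show ?thesis by (simp add: add_eq_0_iff)
qed

text \<open>The shifts of \<open>j / L\<close> by the fractions with denominator \<open>\<Prod>X\<close> see the same sum
  up to sign, because every element of \<open>P\<close> is invertible modulo \<open>\<Prod>X\<close>.\<close>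

lemma sum_exp_sum_shift:
  assumes X: "finite X" "\<And>p. p \<in> X \<Longrightarrow> prime p" "\<And>p. p \<in> X \<Longrightarrow> p dvd L"
    and P: "\<And>p q. p \<in> X \<Longrightarrow> q \<in> P \<Longrightarrow> \<not> p dvd q" and L: "L > 0"
  shows "(\<Sum>b\<in>PiE X (\<lambda>p. {1..<p}). exp_sum P L (j + (\<Sum>p\<in>X. b p * (L div p)))) =
    (-1) ^ card X * exp_sum P L j"
proof -
  have "(\<Sum>b\<in>PiE X (\<lambda>p. {1..<p}). exp_sum P L (j + (\<Sum>p\<in>X. b p * (L div p)))) =
    (\<Sum>b\<in>PiE X (\<lambda>p. {1..<p}). \<Sum>q\<in>P. unit_exp (real q * (real j / real L)) *
        (\<Prod>p\<in>X. unit_exp (real q * (real (b p) / real p))))"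
    unfolding exp_sum_def
  proof (intro sum.cong refl)
    fix b q
    \<comment> \<open>Division by \<open>p\<close> is exact here since \<open>p dvd L\<close>, so
      the index shift \<open>b p * (L div p)\<close> moves the grid point by the fraction
      \<open>b p / p\<close>.\<close>
    have "real (\<Sum>p\<in>X. b p * (L div p)) / real L = (\<Sum>p\<in>X. real (b p) / real p)"
      using X L by (auto simp: sum_divide_distrib real_of_nat_div intro!: sum.cong)
    then have "real q * (real (j + (\<Sum>p\<in>X. b p * (L div p))) / real L) =
       real q * (real j / real L) + (\<Sum>p\<in>X. real q * (real (b p) / real p))"
      by (simp add: add_divide_distrib distrib_left sum_distrib_left del: of_nat_sum)
    then show "unit_exp (real q * (real (j + (\<Sum>p\<in>X. b p * (L div p))) / real L)) =
        unit_exp (real q * (real j / real L)) * (\<Prod>p\<in>X. unit_exp (real q * (real (b p) / real p)))"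
      by (simp only: unit_exp_add unit_exp_sum)
  qed
  also have "\<dots> = (\<Sum>q\<in>P. unit_exp (real q * (real j / real L)) *
        (\<Sum>b\<in>PiE X (\<lambda>p. {1..<p}). \<Prod>p\<in>X. unit_exp (real q * (real (b p) / real p))))"
    by (subst sum.swap) (simp add: sum_distrib_left)
  also have "\<dots> = (\<Sum>q\<in>P. unit_exp (real q * (real j / real L)) *
        (\<Prod>p\<in>X. \<Sum>b\<in>{1..<p}. unit_exp (real q * (real b / real p))))"
    using X by (subst prod_sum_PiE) auto
  also have "\<dots> = (\<Sum>q\<in>P. unit_exp (real q * (real j / real L)) * (-1) ^ card X)"
  proof (intro sum.cong refl)
    fix q assume "q \<in> P"
    then have "(\<Prod>p\<in>X. \<Sum>b\<in>{1..<p}. unit_exp (real q * (real b / real p))) = (\<Prod>p\<in>X. -1)"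
      using X P by (intro prod.cong refl sum_unit_exp_prime) auto
    then show "unit_exp (real q * (real j / real L)) * (\<Prod>p\<in>X. \<Sum>b\<in>{1..<p}. unit_exp (real q * (real b / real p))) =
      unit_exp (real q * (real j / real L)) * (-1) ^ card X" by simp
  qed
  finally show ?thesis by (simp add: exp_sum_def sum_distrib_left mult.commute)
qed

text \<open>Cauchy-Schwarz applied to the shift identity, with \<open>\<Prod>(p - 1)\<close> shifts.
  This is the basic inequality of the large sieve in Montgomery's form.\<close>

lemma cmod_exp_sum_squared_le_shifts:
  assumes X: "finite X" "\<And>p. p \<in> X \<Longrightarrow> prime p" "\<And>p. p \<in> X \<Longrightarrow> p dvd L"
    and P: "\<And>p q. p \<in> X \<Longrightarrow> q \<in> P \<Longrightarrow> \<not> p dvd q" and L: "L > 0"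
  shows "(cmod (exp_sum P L j))\<^sup>2 * (\<Prod>p\<in>X. 1 / (real p - 1)) \<le>
    (\<Sum>b\<in>PiE X (\<lambda>p. {1..<p}). (cmod (exp_sum P L ((j + (\<Sum>p\<in>X. b p * (L div p))) mod L)))\<^sup>2)"
proof -
  let ?I = "PiE X (\<lambda>p. {1..<p})"
  let ?f = "\<lambda>b. cmod (exp_sum P L ((j + (\<Sum>p\<in>X. b p * (L div p))) mod L))"
  have p1: "real p > 1" if "p \<in> X" for p using X(2)[OF that] prime_gt_1_nat by simp
  have card: "real (card ?I) = (\<Prod>p\<in>X. real p - 1)"
    using X(1) p1 by (subst card_PiE) (auto simp: of_nat_diff Suc_le_eq intro!: prod.cong dest!: p1)
  have pos: "(\<Prod>p\<in>X. real p - 1) > 0" using p1 by (intro prod_pos) auto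
  have "cmod (exp_sum P L j) = cmod ((-1) ^ card X * exp_sum P L j)" by (simp add: norm_mult norm_power)
  also have "\<dots> = cmod (\<Sum>b\<in>?I. exp_sum P L ((j + (\<Sum>p\<in>X. b p * (L div p))) mod L))"
    using sum_exp_sum_shift[OF assms] by (simp add: exp_sum_cong_mod[OF L])
  also have "\<dots> \<le> (\<Sum>b\<in>?I. ?f b)" by (rule norm_sum)
  finally have "(cmod (exp_sum P L j))\<^sup>2 \<le> (\<Sum>b\<in>?I. ?f b)\<^sup>2" by (intro power_mono) auto
  also have "\<dots> \<le> real (card ?I) * (\<Sum>b\<in>?I. (?f b)\<^sup>2)"
    using sum_squared_le_sum_of_squares[of ?f ?I] by (simp add: mult.commute)
  finally show ?thesis using pos unfolding card by (simp add: prod_dividef field_simps)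
qed

text \<open>Used to show that points near fractions with denominators \<open>m\<close> and
  \<open>m'\<close> stay distinct modulo 1 after shifts whose denominators are coprime to
  \<open>m\<close> and \<open>m'\<close>. Multiplying the relation by
  \<open>m * m' * \<Prod>Y\<close> makes both sides integers up to an error below 1. The resulting
  exact identity, read modulo \<open>p\<close>, leaves only the term of \<open>p\<close>.\<close>

lemma fractions_separated:
  fixes m m' :: nat and a a' t :: int and c :: "nat \<Rightarrow> int"
  assumes Y: "finite Y" "\<And>p. p \<in> Y \<Longrightarrow> prime p" "\<And>p. p \<in> Y \<Longrightarrow> \<not> p dvd m \<and> \<not> p dvd m'"
    and eq: "(\<Sum>p\<in>Y. of_int (c p) / real p) = x' - x + of_int t"
    and x: "\<bar>real m * x - of_int a\<bar> \<le> B" "\<bar>real m' * x' - of_int a'\<bar> \<le> B"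
    and small: "real (\<Prod>Y) * (real m + real m') * B < 1"
    and p: "p \<in> Y" "\<bar>c p\<bar> < int p"
  shows "c p = 0"
proof -
  define D where "D = \<Prod>Y"
  \<comment> \<open>The value that \<open>m * m' * (x' - x + t)\<close> would have if
    \<open>m * x = a\<close> and \<open>m' * x' = a'\<close> held exactly.\<close>
  define z where "z = int m * a' - int m' * a + int m * int m' * t"
  define I where "I = int m * int m' * (\<Sum>p\<in>Y. c p * int (\<Prod>(Y - {p})))"
  have D_eq: "D = p * \<Prod>(Y - {p})" if "p \<in> Y" for p
    unfolding D_def using Y(1) that by (rule prod.remove)
  have "(\<Sum>p\<in>Y. of_int (c p) / real p) * real D = of_int (\<Sum>p\<in>Y. c p * int (\<Prod>(Y - {p})))"
    unfolding sum_distrib_right of_int_sum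
  proof (rule sum.cong)
    fix p assume "p \<in> Y"
    then show "of_int (c p) / real p * real D = of_int (c p * int (\<Prod>(Y - {p})))"
      using D_eq[of p] Y(2) prime_gt_0_nat[of p] by simp
  qed simp
  then have "real_of_int (\<Sum>p\<in>Y. c p * int (\<Prod>(Y - {p}))) = (x' - x + of_int t) * real D"
    unfolding eq by (rule sym)
  then have "of_int I = real m * real m' * ((x' - x + of_int t) * real D)"
    by (simp only: I_def of_int_mult of_int_of_nat_eq)
  then have "of_int (I - int D * z) = real D * (real m * (real m' * x' - of_int a') - real m' * (real m * x - of_int a))"
    by (simp add: z_def algebra_simps)
  also have "\<bar>\<dots>\<bar> = real D * \<bar>real m * (real m' * x' - of_int a') - real m' * (real m * x - of_int a)\<bar>"
    by (simp add: abs_mult)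
  also have "\<dots> \<le> real D * (real m * B + real m' * B)"
  proof (intro mult_left_mono)
    have "\<bar>real m * (real m' * x' - of_int a') - real m' * (real m * x - of_int a)\<bar> \<le>
       real m * \<bar>real m' * x' - of_int a'\<bar> + real m' * \<bar>real m * x - of_int a\<bar>"
      by (metis abs_mult abs_of_nat abs_triangle_ineq4)
    also have "\<dots> \<le> real m * B + real m' * B" by (intro add_mono mult_left_mono x) auto
    finally show "\<bar>real m * (real m' * x' - of_int a') - real m' * (real m * x - of_int a)\<bar> \<le> real m * B + real m' * B" .
  qed auto
  also have "\<dots> < 1" using small by (simp add: D_def algebra_simps)
  finally have "\<bar>I - int D * z\<bar> < 1" by linarith
  then have I: "I = int D * z" by simp
  have pp: "prime (int p)" using Y(2)[OF p(1)] by simp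
  have "int p dvd I" unfolding I D_eq[OF p(1)] by simp
  moreover have "(\<Sum>q\<in>Y. c q * int (\<Prod>(Y - {q}))) = c p * int (\<Prod>(Y - {p})) + (\<Sum>q\<in>Y - {p}. c q * int (\<Prod>(Y - {q})))"
    using Y(1) p(1) by (rule sum.remove)
  moreover have "int p dvd (\<Sum>q\<in>Y - {p}. c q * int (\<Prod>(Y - {q})))"
  proof (intro dvd_sum dvd_mult)
    fix q assume "q \<in> Y - {p}"
    then have "p dvd \<Prod>(Y - {q})" using Y(1) p(1) by (intro dvd_prodI) auto
    then show "int p dvd int (\<Prod>(Y - {q}))" by (simp only: of_nat_dvd_iff)
  qed
  ultimately have "int p dvd int m * int m' * (c p * int (\<Prod>(Y - {p})))"
    by (simp only: I_def distrib_left dvd_add_left_iff dvd_mult)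
  moreover have "\<not> int p dvd int m" "\<not> int p dvd int m'" using Y(3)[OF p(1)] by auto
  moreover have "\<not> int p dvd int (\<Prod>(Y - {p}))"
    unfolding of_nat_dvd_iff
  proof
    assume "p dvd \<Prod>(Y - {p})"
    then obtain q where "q \<in> Y - {p}" "p dvd q"
      using Y p(1) by (metis (no_types, lifting) finite_Diff prime_dvd_prod_iff)
    then show False using Y(2) p(1) primes_dvd_imp_eq by blast
  qed
  ultimately have "int p dvd c p" using pp by (simp add: prime_dvd_mult_iff del: of_nat_prod of_nat_dvd_iff)
  then show ?thesis using p(2) zdvd_not_zless[of "\<bar>c p\<bar>" "int p"] by auto
qed

text \<open>Each point of \<open>A\<close> is shifted by all reduced fractions whose denominator is
  a squarefree number up to \<open>R\<close> free of primes from \<open>Z\<close>. The shifted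
  points are pairwise distinct, so their masses add up to at most the total mass; each single point
  receives back its own mass with the weight bounded in \<open>sum_prime_products_ge\<close>. The
  number of fractions near which \<open>A\<close> lies does not matter.\<close>

lemma sum_cmod_exp_sum_squared_le_near_fractions:
  fixes Z :: "nat set" and L M R :: nat
  assumes L: "L > 0" "\<And>p. prime p \<Longrightarrow> p \<le> R \<Longrightarrow> p dvd L"
    and P: "finite P" "P \<subseteq> {..<L}" "\<And>p. p \<in> P \<Longrightarrow> prime p \<and> R < p"
    and A: "A \<subseteq> {..<L}"
      "\<And>j. j \<in> A \<Longrightarrow> \<exists>m (a::int). m \<le> M \<and> (\<forall>p. prime p \<longrightarrow> p dvd m \<longrightarrow> p \<in> Z) \<and>
          \<bar>real m * (real j / real L) - of_int a\<bar> \<le> B"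
    and small: "2 * real M * B * (real R)\<^sup>2 < 1"
    and Z: "finite Z" "\<And>p. p \<in> Z \<Longrightarrow> prime p"
  shows "ln (real R + 1) * (\<Sum>j\<in>A. (cmod (exp_sum P L j))\<^sup>2) \<le>
    (\<Prod>p\<in>Z. real p / (real p - 1)) * (real L * real (card P))"
proof (cases "A = {}")
  case True
  have "real p - 1 \<ge> 0" if "p \<in> Z" for p using Z(2)[OF that] prime_ge_1_nat by simp
  then have "(\<Prod>p\<in>Z. real p / (real p - 1)) \<ge> 0" by (intro prod_nonneg) auto
  then show ?thesis using True by simp
next
  case False
  define XX where "XX = {X. X \<subseteq> {p. prime p \<and> p \<le> R} - Z \<and> \<Prod>X \<le> R}"
  define I where "I = (\<lambda>X::nat set. PiE X (\<lambda>p. {1..<p}))"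
  define \<phi> where "\<phi> = (\<lambda>(j, X, b). (j + (\<Sum>p\<in>X. b p * (L div p))) mod L)"
  define U where "U = Sigma A (\<lambda>j. Sigma XX I)"
  define F where "F = (\<lambda>j. (cmod (exp_sum P L j))\<^sup>2)"
  define g where "g = (\<Sum>X\<in>XX. \<Prod>p\<in>X. 1 / (real p - 1))"
  have finX: "finite X" if "X \<in> XX" for X
    using that by (auto simp: XX_def intro: finite_subset[of _ "{..R}"])
  have finXX: "finite XX" unfolding XX_def
    by (rule finite_subset[of _ "Pow {p. p \<le> R}"]) auto
  have finI: "finite (I X)" if "X \<in> XX" for X
    unfolding I_def using finX[OF that] by (intro finite_PiE) auto
  have finA: "finite A" using A(1) finite_subset by blast
  have X: "prime p" "p dvd L" "p \<notin> Z" "p \<le> R" if "X \<in> XX" "p \<in> X" for X p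
    using that L(2) by (auto simp: XX_def)
  have B: "B \<ge> 0" using A(2) False by (meson abs_ge_zero all_not_in_conv order_trans)
  have inj: "inj_on \<phi> U"
  proof (rule inj_onI, clarsimp simp: U_def)
    fix j X b j' X' b'
    assume j: "j \<in> A" "j' \<in> A" and XX: "X \<in> XX" "X' \<in> XX" and b: "b \<in> I X" "b' \<in> I X'"
      and eq: "\<phi> (j, X, b) = \<phi> (j', X', b')"
    define Y where "Y = X \<union> X'"
    \<comment> \<open>The numerators \<open>b\<close> and \<open>b'\<close> are extended by 0 to
      \<open>X \<union> X'\<close>. Genuine numerators are nonzero, so \<open>c p = 0\<close> for
      all \<open>p\<close> will also force \<open>X = X'\<close>.\<close>
    define c where "c = (\<lambda>p. (if p \<in> X then int (b p) else 0) - (if p \<in> X' then int (b' p) else 0))"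
    have finY: "finite Y" using finX XX by (auto simp: Y_def)
    obtain m a where m: "m \<le> M" "\<And>p. prime p \<Longrightarrow> p dvd m \<Longrightarrow> p \<in> Z"
      "\<bar>real m * (real j / real L) - of_int a\<bar> \<le> B" using A(2)[OF j(1)] by blast
    obtain m' a' where m': "m' \<le> M" "\<And>p. prime p \<Longrightarrow> p dvd m' \<Longrightarrow> p \<in> Z"
      "\<bar>real m' * (real j' / real L) - of_int a'\<bar> \<le> B" using A(2)[OF j(2)] by blast
    have bnd: "1 \<le> b p" "b p < p" if "p \<in> X" for p using b that by (auto simp: I_def)
    have bnd': "1 \<le> b' p" "b' p < p" if "p \<in> X'" for p using b that by (auto simp: I_def)
    have L_div: "real (\<Sum>p\<in>X. b p * (L div p)) = real L * (\<Sum>p\<in>X. real (b p) / real p)"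
      if "X \<in> XX" for X and b :: "nat \<Rightarrow> nat"
      using X[OF that] by (auto simp: sum_distrib_left real_of_nat_div intro!: sum.cong)
    have "(j + (\<Sum>p\<in>X. b p * (L div p))) mod L = (j' + (\<Sum>p\<in>X'. b' p * (L div p))) mod L"
      using eq by (simp add: \<phi>_def)
    then obtain t where "int (j + (\<Sum>p\<in>X. b p * (L div p))) = int (j' + (\<Sum>p\<in>X'. b' p * (L div p))) + int L * t"
      by (metis mod_eqE mult.commute zmod_int)
    then have "real_of_int (int (j + (\<Sum>p\<in>X. b p * (L div p)))) =
        real_of_int (int (j' + (\<Sum>p\<in>X'. b' p * (L div p))) + int L * t)" by (rule arg_cong)
    then have "real j + real L * (\<Sum>p\<in>X. real (b p) / real p) =
        real j' + real L * (\<Sum>p\<in>X'. real (b' p) / real p) + real L * of_int t"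
      by (simp only: of_int_add of_int_mult of_int_of_nat_eq of_nat_add L_div[OF XX(1)] L_div[OF XX(2)])
    then have "(\<Sum>p\<in>X. real (b p) / real p) - (\<Sum>p\<in>X'. real (b' p) / real p) = real j' / real L - real j / real L + of_int t"
      using L(1) by (simp add: field_simps)
    moreover have "(\<Sum>p\<in>X. real (b p) / real p) = (\<Sum>p\<in>Y. (if p \<in> X then real (b p) else 0) / real p)"
      unfolding Y_def by (rule sum.mono_neutral_cong_left) (use finY in \<open>auto simp: Y_def\<close>)
    moreover have "(\<Sum>p\<in>X'. real (b' p) / real p) = (\<Sum>p\<in>Y. (if p \<in> X' then real (b' p) else 0) / real p)"
      unfolding Y_def by (rule sum.mono_neutral_cong_left) (use finY in \<open>auto simp: Y_def\<close>)
    ultimately have sum_eq: "(\<Sum>p\<in>Y. of_int (c p) / real p) = real j' / real L - real j / real L + of_int t"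
      by (auto simp: c_def sum_subtractf[symmetric] diff_divide_distrib intro!: sum.cong elim!: trans[rotated])
    \<comment> \<open>The common denominator of two shifts is at most \<open>R * R\<close>, which is
      the source of the factor \<open>(real R)\<^sup>2\<close> in \<open>small\<close>.\<close>
    have "real (\<Prod>Y) \<le> (real R)\<^sup>2"
    proof -
      have "\<Prod>Y \<le> \<Prod>X * \<Prod>X'"
      proof -
        have "\<Prod>X * \<Prod>X' = \<Prod>Y * \<Prod>(X \<inter> X')"
          unfolding Y_def using finX XX by (simp add: prod.union_inter)
        moreover have "\<Prod>(X \<inter> X') \<ge> 1"
          using prime_gt_0_nat[OF X(1)[OF XX(1)]] by (intro prod_ge_1) (auto simp: Suc_le_eq)
        ultimately show ?thesis by simp
      qed
      also have "\<dots> \<le> R * R" using XX by (intro mult_mono) (auto simp: XX_def)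
      finally have "real (\<Prod>Y) \<le> real (R * R)" by (simp only: of_nat_le_iff)
      then show ?thesis by (simp add: power2_eq_square)
    qed
    then have "real (\<Prod>Y) * ((real m + real m') * B) \<le> (real R)\<^sup>2 * ((real M + real M) * B)"
      using m(1) m'(1) B by (intro mult_mono mult_right_mono) auto
    then have sm: "real (\<Prod>Y) * (real m + real m') * B < 1" using small by (simp add: algebra_simps)
    have c0: "c p = 0" if "p \<in> Y" for p
    proof (rule fractions_separated[where Y = Y and m = m and m' = m' and c = c and B = B])
      show "\<bar>c p\<bar> < int p" using bnd[of p] bnd'[of p] that by (auto simp: c_def Y_def)
      show "\<not> q dvd m \<and> \<not> q dvd m'" if "q \<in> Y" for q
        using that X(1,3)[OF XX(1)] X(1,3)[OF XX(2)] m(2) m'(2) unfolding Y_def by blast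
    qed (use finY X XX sum_eq m m' sm that in \<open>auto simp: Y_def\<close>)
    have XeX: "X = X'"
    proof (rule set_eqI)
      fix p
      show "p \<in> X \<longleftrightarrow> p \<in> X'" using c0[of p] bnd[of p] bnd'[of p]
        by (cases "p \<in> X"; cases "p \<in> X'") (auto simp: c_def Y_def)
    qed
    moreover have beb: "b = b'"
    proof (rule PiE_ext[of _ X])
      show "b p = b' p" if "p \<in> X" for p
        using c0[of p] that XeX by (auto simp: c_def Y_def)
    qed (use b XeX in \<open>auto simp: I_def\<close>)
    moreover have "j = j'"
    proof -
      have "real j / real L = real j' / real L + of_int t" using sum_eq c0 by simp
      then have "real j = real_of_int (int j' + int L * t)" using L(1) by (simp add: field_simps)
      then have "int j = int j' + int L * t" by (simp only: of_int_of_nat_eq[symmetric, where 'a=real] of_int_eq_iff)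
      then have "int j mod int L = int j' mod int L" by simp
      then have "j mod L = j' mod L" by (simp flip: zmod_int)
      then show ?thesis using subsetD[OF A(1) j(1)] subsetD[OF A(1) j(2)] by simp
    qed
    ultimately show "j = j' \<and> X = X' \<and> b = b'" by simp
  qed
  have "g * (\<Sum>j\<in>A. F j) = (\<Sum>j\<in>A. \<Sum>X\<in>XX. F j * (\<Prod>p\<in>X. 1 / (real p - 1)))"
    unfolding g_def by (subst mult.commute) (simp add: sum_product)
  also have "\<dots> \<le> (\<Sum>j\<in>A. \<Sum>X\<in>XX. \<Sum>b\<in>I X. F (\<phi> (j, X, b)))"
  proof (intro sum_mono)
    fix j X assume XX: "X \<in> XX"
    have "\<not> p dvd q" if "p \<in> X" "q \<in> P" for p q
      using X[OF XX that(1)] P(3)[OF that(2)] primes_dvd_imp_eq[of p q] by auto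
    then show "F j * (\<Prod>p\<in>X. 1 / (real p - 1)) \<le> (\<Sum>b\<in>I X. F (\<phi> (j, X, b)))"
      unfolding F_def I_def \<phi>_def prod.case
      using X[OF XX] finX[OF XX] L(1) by (intro cmod_exp_sum_squared_le_shifts) auto
  qed
  also have "\<dots> = (\<Sum>u\<in>U. F (\<phi> u))"
    unfolding U_def using finA finXX finI by (simp add: sum.Sigma)
  also have "\<dots> = (\<Sum>j\<in>\<phi> ` U. F j)"
    by (simp add: sum.reindex[OF inj])
  also have "\<dots> \<le> (\<Sum>j<L. F j)"
    by (rule sum_mono2) (use L(1) in \<open>auto simp: F_def \<phi>_def split: prod.splits\<close>)
  also have "\<dots> = real L * real (card P)"
    unfolding F_def using L(1) P by (intro sum_cmod_exp_sum_squared) auto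
  finally have le: "g * (\<Sum>j\<in>A. F j) \<le> real L * real (card P)" .
  have Zp: "(\<Prod>p\<in>Z. real p / (real p - 1)) \<ge> 0"
    using Z(2) prime_ge_1_nat by (intro prod_nonneg) fastforce
  have "ln (real R + 1) * (\<Sum>j\<in>A. F j) \<le> ((\<Prod>p\<in>Z. real p / (real p - 1)) * g) * (\<Sum>j\<in>A. F j)"
    using sum_prime_products_ge[OF Z, of R]
    by (intro mult_right_mono sum_nonneg) (auto simp: g_def XX_def F_def)
  also have "\<dots> \<le> (\<Prod>p\<in>Z. real p / (real p - 1)) * (real L * real (card P))"
    unfolding mult.assoc using le Zp by (rule mult_left_mono)
  finally show ?thesis unfolding F_def .
qed

section \<open>Quadratic exponential sums\<close>

lemma sum_square_off_diagonal:
  fixes F :: "nat \<Rightarrow> nat \<Rightarrow> 'a::ab_group_add"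
  shows "(\<Sum>v=1..V. \<Sum>w=1..V. F v w) =
    (\<Sum>v=1..V. F v v) + (\<Sum>h=1..V. \<Sum>u=1..V - h. F (u + h) u + F u (u + h))"
proof (induction V)
  case (Suc V)
  have "(\<Sum>h=1..Suc V. \<Sum>u=1..Suc V - h. F (u + h) u + F u (u + h)) =
      (\<Sum>h=1..V. \<Sum>u=1..Suc (V - h). F (u + h) u + F u (u + h))"
    by (simp add: Suc_diff_le)
  also have "\<dots> = (\<Sum>h=1..V. \<Sum>u=1..V - h. F (u + h) u + F u (u + h)) +
      (\<Sum>h=1..V. F (Suc V) (Suc V - h) + F (Suc V - h) (Suc V))"
    unfolding sum.distrib[symmetric] by (intro sum.cong refl) (auto simp: Suc_diff_le)
  also have "(\<Sum>h=1..V. F (Suc V) (Suc V - h) + F (Suc V - h) (Suc V)) = (\<Sum>u=1..V. F (Suc V) u + F u (Suc V))"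
    by (subst (2) sum.atLeastAtMost_rev) (intro sum.cong refl, auto)
  finally have *: "(\<Sum>h=1..Suc V. \<Sum>u=1..Suc V - h. F (u + h) u + F u (u + h)) =
     (\<Sum>h=1..V. \<Sum>u=1..V - h. F (u + h) u + F u (u + h)) + (\<Sum>u=1..V. F (Suc V) u + F u (Suc V))" .
  have "(\<Sum>v=1..Suc V. \<Sum>w=1..Suc V. F v w) =
     (\<Sum>v=1..V. \<Sum>w=1..V. F v w) + F (Suc V) (Suc V) + (\<Sum>u=1..V. F (Suc V) u + F u (Suc V))"
    by (simp add: sum.distrib algebra_simps)
  then show ?case unfolding * Suc.IH by (simp add: algebra_simps)
qed simp

text \<open>Weyl differencing: with \<open>v = u + h\<close> and \<open>w = u\<close> the phase
  difference \<open>\<gamma> * (h\<^sup>2 + 2 * h * u)\<close> is linear in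
  \<open>u\<close>.\<close>

lemma cmod_quadratic_sum_squared_le:
  "(cmod (\<Sum>v=1..V. unit_exp (\<gamma> * (real v)\<^sup>2)))\<^sup>2 \<le>
     real V + 2 * (\<Sum>h=1..V. cmod (\<Sum>u=1..V - h. unit_exp (2 * real h * \<gamma> * real u)))"
proof -
  define f where "f = (\<lambda>v::nat. unit_exp (\<gamma> * (real v)\<^sup>2))"
  define I where "I = (\<lambda>h. \<Sum>u=1..V - h. unit_exp (2 * real h * \<gamma> * real u))"
  have sh: "f (u + h) * cnj (f u) = unit_exp (\<gamma> * (real h)\<^sup>2) * unit_exp (2 * real h * \<gamma> * real u)" for u h
    by (simp add: f_def cnj_unit_exp unit_exp_add[symmetric] power2_eq_square algebra_simps)
  have sh': "f u * cnj (f (u + h)) = cnj (unit_exp (\<gamma> * (real h)\<^sup>2) * unit_exp (2 * real h * \<gamma> * real u))" for u h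
    by (simp add: sh[symmetric])
  have "complex_of_real ((cmod (sum f {1..V}))\<^sup>2) = (\<Sum>v=1..V. \<Sum>w=1..V. f v * cnj (f w))"
    unfolding complex_norm_square cnj_sum sum_product ..
  also have "\<dots> = (\<Sum>v=1..V. f v * cnj (f v)) +
      (\<Sum>h=1..V. \<Sum>u=1..V - h. f (u + h) * cnj (f u) + f u * cnj (f (u + h)))"
    by (rule sum_square_off_diagonal)
  also have "(\<Sum>v=1..V. f v * cnj (f v)) = of_nat V"
    by (simp add: f_def complex_norm_square[symmetric])
  also have "(\<Sum>h=1..V. \<Sum>u=1..V - h. f (u + h) * cnj (f u) + f u * cnj (f (u + h))) =
      (\<Sum>h=1..V. unit_exp (\<gamma> * (real h)\<^sup>2) * I h + cnj (unit_exp (\<gamma> * (real h)\<^sup>2) * I h))"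
    unfolding sh sh' I_def by (simp only: sum.distrib sum_distrib_left complex_cnj_mult cnj_sum)
  finally have "complex_of_real ((cmod (sum f {1..V}))\<^sup>2) =
      of_nat V + (\<Sum>h=1..V. unit_exp (\<gamma> * (real h)\<^sup>2) * I h + cnj (unit_exp (\<gamma> * (real h)\<^sup>2) * I h))" .
  then have "cmod (complex_of_real ((cmod (sum f {1..V}))\<^sup>2)) =
      cmod (of_nat V + (\<Sum>h=1..V. unit_exp (\<gamma> * (real h)\<^sup>2) * I h + cnj (unit_exp (\<gamma> * (real h)\<^sup>2) * I h)))"
    by (rule arg_cong)
  also have "\<dots> \<le> cmod (of_nat V :: complex) +
      cmod (\<Sum>h=1..V. unit_exp (\<gamma> * (real h)\<^sup>2) * I h + cnj (unit_exp (\<gamma> * (real h)\<^sup>2) * I h))"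
    by (rule norm_triangle_ineq)
  also have "\<dots> \<le> real V + (\<Sum>h=1..V. 2 * cmod (I h))"
  proof (intro add_mono sum_norm_le)
    fix h
    have "cmod (unit_exp (\<gamma> * (real h)\<^sup>2) * I h + cnj (unit_exp (\<gamma> * (real h)\<^sup>2) * I h)) \<le>
       cmod (unit_exp (\<gamma> * (real h)\<^sup>2) * I h) + cmod (cnj (unit_exp (\<gamma> * (real h)\<^sup>2) * I h))"
      by (rule norm_triangle_ineq)
    then show "cmod (unit_exp (\<gamma> * (real h)\<^sup>2) * I h + cnj (unit_exp (\<gamma> * (real h)\<^sup>2) * I h)) \<le> 2 * cmod (I h)"
      by (simp add: norm_mult)
  qed simp
  finally show ?thesis
    by (simp add: f_def I_def sum_distrib_left norm_power)
qed

lemma sin_pi_ge: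
  assumes "0 \<le> r" "r \<le> 1 / 2"
  shows "2 * r \<le> sin (pi * r)"
proof -
  have "convex_on {0..pi / 2} (\<lambda>x. - sin x)"
    by (rule f''_ge0_imp_convex[where f' = "\<lambda>x. - cos x" and f'' = sin])
       (auto intro!: derivative_eq_intros sin_ge_zero)
  from convex_onD[OF this, of "2 * r" 0 "pi / 2"] assms show ?thesis
    by (simp add: mult.commute)
qed

lemma cmod_one_minus_unit_exp_ge:
  assumes "\<bar>r\<bar> \<le> 1 / 2"
  shows "4 * \<bar>r\<bar> \<le> cmod (1 - unit_exp r)"
proof -
  have "(cmod (1 - unit_exp r))\<^sup>2 = 2 - 2 * cos (2 * (pi * r))"
    by (simp add: unit_exp_def cmod_power2 power2_diff algebra_simps)
  also have "\<dots> = 4 * (sin (pi * \<bar>r\<bar>))\<^sup>2"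
    by (simp add: cos_double_sin abs_if)
  also have "\<dots> \<ge> 4 * (2 * \<bar>r\<bar>)\<^sup>2"
    using sin_pi_ge[of "\<bar>r\<bar>"] assms by (intro mult_left_mono power_mono) auto
  finally have "(4 * \<bar>r\<bar>)\<^sup>2 \<le> (cmod (1 - unit_exp r))\<^sup>2" by (simp add: power_mult_distrib)
  then show ?thesis by (rule power2_le_imp_le) simp
qed

text \<open>The geometric sum is at most \<open>2 / cmod (1 - unit_exp r)\<close>, where
  \<open>r\<close> is the signed distance of \<open>\<theta>\<close> to the nearest integer, and the
  denominator is at least four times the absolute value of \<open>r\<close>.\<close>

lemma large_linear_sum_imp_near_int:
  assumes "c > 0" "c \<le> cmod (\<Sum>u=1..n. unit_exp (\<theta> * real u))"
  shows "\<exists>a::int. \<bar>\<theta> - of_int a\<bar> \<le> 1 / (2 * c)"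
proof (intro exI)
  define r where "r = \<theta> - of_int (round \<theta>)"
  have r: "\<bar>r\<bar> \<le> 1 / 2" unfolding r_def using of_int_round_abs_le[of \<theta>] by (simp add: abs_minus_commute)
  have x: "unit_exp \<theta> = unit_exp r"
    using unit_exp_add_of_int[of r "round \<theta>"] by (simp add: r_def)
  have "(\<Sum>u=1..n. unit_exp (\<theta> * real u)) = (\<Sum>u=1..n. unit_exp r ^ u)"
    by (intro sum.cong refl) (simp flip: unit_exp_power x add: mult.commute)
  moreover have "(1 - unit_exp r) * (\<Sum>u=1..n. unit_exp r ^ u) = unit_exp r - unit_exp r ^ Suc n"
  proof (induction n)
    case (Suc n)
    have "(1 - unit_exp r) * (\<Sum>u=1..Suc n. unit_exp r ^ u) =
        (1 - unit_exp r) * (\<Sum>u=1..n. unit_exp r ^ u) + (1 - unit_exp r) * unit_exp r ^ Suc n"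
      by (simp add: distrib_left)
    also have "\<dots> = (unit_exp r - unit_exp r ^ Suc n) + (1 - unit_exp r) * unit_exp r ^ Suc n"
      by (simp only: Suc.IH)
    also have "\<dots> = unit_exp r - unit_exp r ^ Suc (Suc n)" by (simp add: algebra_simps)
    finally show ?case .
  qed simp
  ultimately have "cmod (1 - unit_exp r) * cmod (\<Sum>u=1..n. unit_exp (\<theta> * real u)) = cmod (unit_exp r - unit_exp r ^ Suc n)"
    by (metis norm_mult)
  also have "\<dots> \<le> cmod (unit_exp r) + cmod (unit_exp r ^ Suc n)" by (rule norm_triangle_ineq4)
  also have "\<dots> = 2" by (simp add: norm_mult norm_power)
  finally have "cmod (1 - unit_exp r) * cmod (\<Sum>u=1..n. unit_exp (\<theta> * real u)) \<le> 2" .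
  moreover have "(4 * \<bar>r\<bar>) * c \<le> cmod (1 - unit_exp r) * cmod (\<Sum>u=1..n. unit_exp (\<theta> * real u))"
    using cmod_one_minus_unit_exp_ge[OF r] assms by (intro mult_mono) auto
  ultimately show "\<bar>\<theta> - of_int (round \<theta>)\<bar> \<le> 1 / (2 * c)"
    using assms(1) by (simp add: r_def[symmetric] field_simps)
qed

section \<open>Counting multiples close to integers\<close>

lemma card_int_interval_le:
  fixes A :: "int set"
  assumes "\<And>a. a \<in> A \<Longrightarrow> x \<le> of_int a \<and> of_int a \<le> x + d" "d \<ge> (0::real)"
  shows "finite A" "real (card A) \<le> d + 1"
proof -
  have sub: "A \<subseteq> {\<lceil>x\<rceil>..\<lfloor>x + d\<rfloor>}" using assms(1) by (auto simp: le_floor_iff ceiling_le_iff)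
  then show "finite A" by (rule finite_subset) simp
  have "card A \<le> nat (\<lfloor>x + d\<rfloor> - \<lceil>x\<rceil> + 1)" using card_mono[OF _ sub] by simp
  then have "real (card A) \<le> real (nat (\<lfloor>x + d\<rfloor> - \<lceil>x\<rceil> + 1))" by simp
  also have "\<dots> \<le> d + 1"
  proof (cases "\<lfloor>x + d\<rfloor> - \<lceil>x\<rceil> + 1 \<ge> 0")
    case True
    then have "real (nat (\<lfloor>x + d\<rfloor> - \<lceil>x\<rceil> + 1)) = of_int \<lfloor>x + d\<rfloor> - of_int \<lceil>x\<rceil> + 1" by simp
    then show ?thesis using of_int_floor_le[of "x + d"] le_of_int_ceiling[of x] by linarith
  qed (use assms(2) in simp)
  finally show "real (card A) \<le> d + 1" .
qed

lemma card_nat_interval_le: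
  fixes A :: "nat set"
  assumes "\<And>a. a \<in> A \<Longrightarrow> x \<le> real a \<and> real a \<le> x + d" "d \<ge> (0::real)"
  shows "real (card A) \<le> d + 1"
proof -
  have *: "x \<le> of_int a \<and> of_int a \<le> x + d" if "a \<in> int ` A" for a using that assms(1) by auto
  have "finite (int ` A)" "real (card (int ` A)) \<le> d + 1"
    using card_int_interval_le[of "int ` A" x d, OF * assms(2)] by auto
  then show ?thesis by (simp add: card_image)
qed

text \<open>Along each residue class modulo \<open>q\<close> the multiples of \<open>\<theta>\<close> drift by steps of size \<open>\<kappa>\<close>, so that
  they can stay close to integers only for a proportion about \<open>2 * \<delta>\<close> of the time
  once they have drifted around the circle.\<close>

lemma card_near_int_multiples_le:
  fixes H :: "nat set" and \<theta> \<delta> \<kappa> :: real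
  assumes H: "H \<subseteq> {1..V}" "\<And>h. h \<in> H \<Longrightarrow> \<exists>n::int. \<bar>real h * \<theta> - of_int n\<bar> \<le> \<delta>"
    and q: "q > 0" "\<bar>real q * \<theta> - of_int a\<bar> = \<kappa>" and \<kappa>: "\<kappa> > 0" and \<delta>: "0 \<le> \<delta>" "\<delta> \<le> 1 / 2"
  shows "real (card H) \<le> (real V * \<kappa> + 2 * real q) * (2 * \<delta> / \<kappa> + 1)"
proof -
  define \<rho> where "\<rho> = real q * \<theta> - of_int a"
  have \<rho>: "\<bar>\<rho>\<bar> = \<kappa>" using q by (simp add: \<rho>_def)
  have finH: "finite H" using H finite_subset by blast
  obtain n :: "nat \<Rightarrow> int" where n: "\<And>h. h \<in> H \<Longrightarrow> \<bar>real h * \<theta> - of_int (n h)\<bar> \<le> \<delta>"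
    using H(2) by metis
  \<comment> \<open>With \<open>h = h mod q + q * (h div q)\<close>, the integer part contributed by
    \<open>q * \<theta>\<close> is split off. What remains is the drift
    \<open>(h div q) * \<rho>\<close> away from the starting point
    \<open>(h mod q) * \<theta>\<close>.\<close>
  define k where "k = (\<lambda>h. n h - int (h div q) * a)"
  define \<Phi> where "\<Phi> = (\<lambda>h. (h mod q, k h))"
  have near: "\<bar>real (h mod q) * \<theta> + real (h div q) * \<rho> - of_int (k h)\<bar> \<le> \<delta>" if "h \<in> H" for h
  proof -
    have "real h = real (h mod q) + real q * real (h div q)"
      by (metis mod_mult_div_eq of_nat_add of_nat_mult)
    then have "real (h mod q) * \<theta> + real (h div q) * \<rho> - of_int (k h) = real h * \<theta> - of_int (n h)"
      by (simp add: \<rho>_def k_def algebra_simps)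
    then show ?thesis using n[OF that] by simp
  qed
  \<comment> \<open>With the residue and the target integer fixed, \<open>h div q\<close> lies in an
    interval of length \<open>2 * \<delta> / \<kappa>\<close>: one passage of the drift by that
    integer.\<close>
  have fibre: "real (card {h \<in> H. \<Phi> h = y}) \<le> 2 * \<delta> / \<kappa> + 1" for y
  proof -
    obtain r c where y: "y = (r, c)" by fastforce
    let ?A = "{h \<in> H. \<Phi> h = y}"
    have "inj_on (\<lambda>h. h div q) ?A"
    proof (rule inj_onI)
      fix h h' assume "h \<in> ?A" "h' \<in> ?A" "h div q = h' div q"
      then show "h = h'" by (metis (mono_tags, lifting) \<Phi>_def div_mult_mod_eq fst_conv mem_Collect_eq)
    qed
    then have "card ?A = card ((\<lambda>h. h div q) ` ?A)" by (simp add: card_image)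
    also have "real \<dots> \<le> 2 * \<delta> / \<kappa> + 1"
    proof (rule card_nat_interval_le)
      fix m assume "m \<in> (\<lambda>h. h div q) ` ?A"
      then obtain h where h: "h \<in> H" "h mod q = r" "k h = c" "m = h div q" by (auto simp: \<Phi>_def y)
      have "\<bar>real r * \<theta> + real m * \<rho> - of_int c\<bar> \<le> \<delta>" using near[OF h(1)] h by simp
      moreover have "real r * \<theta> + real m * \<rho> - of_int c = \<rho> * (real m - (of_int c - real r * \<theta>) / \<rho>)"
        using \<rho> \<kappa> by (auto simp: field_simps)
      ultimately have "\<kappa> * \<bar>real m - (of_int c - real r * \<theta>) / \<rho>\<bar> \<le> \<delta>" by (simp add: abs_mult \<rho>)
      then have "\<bar>real m - (of_int c - real r * \<theta>) / \<rho>\<bar> \<le> \<delta> / \<kappa>" using \<kappa> by (simp add: field_simps)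
      then show "(of_int c - real r * \<theta>) / \<rho> - \<delta> / \<kappa> \<le> real m \<and>
         real m \<le> (of_int c - real r * \<theta>) / \<rho> - \<delta> / \<kappa> + 2 * \<delta> / \<kappa>" by (auto simp: abs_le_iff)
    qed (use \<delta> \<kappa> in auto)
    finally show ?thesis .
  qed
  define K where "K = (\<lambda>r. k ` {h \<in> H. h mod q = r})"
  have K: "finite (K r) \<and> real (card (K r)) \<le> real V * \<kappa> / real q + 2" for r
  proof -
    define l where "l = real V * \<kappa> / real q"
    have l0: "l \<ge> 0" using \<kappa> by (simp add: l_def)
    \<comment> \<open>The total drift has length at most \<open>l\<close> and goes down when
      \<open>\<rho>\<close> is negative, so the interval of reachable integers then starts lower by
      \<open>l\<close>.\<close>
    define x where "x = real r * \<theta> - \<delta> + (if \<rho> < 0 then - l else 0)"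
    have *: "x \<le> of_int c \<and> of_int c \<le> x + (l + 2 * \<delta>)" if c: "c \<in> K r" for c
    proof -
      obtain h where h: "h \<in> H" "h mod q = r" "k h = c" using c by (auto simp: K_def)
      have "real (h div q) \<le> real V / real q"
      proof -
        have "real (h div q) \<le> real h / real q" by (rule of_nat_div_le_of_nat)
        also have "\<dots> \<le> real V / real q" using H h by (intro divide_right_mono) auto
        finally show ?thesis .
      qed
      then have "real (h div q) * \<kappa> \<le> l" using \<kappa> unfolding l_def
        by (metis less_eq_real_def mult_right_mono times_divide_eq_left)
      moreover have "0 \<le> real (h div q) * \<kappa>" using \<kappa> by simp
      moreover have "real (h div q) * \<rho> = (if \<rho> < 0 then - (real (h div q) * \<kappa>) else real (h div q) * \<kappa>)"
        using \<rho> by auto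
      ultimately show ?thesis using near[OF h(1)] h(2,3) unfolding x_def abs_le_iff
        by (auto split: if_splits)
    qed
    have "finite (K r)" "real (card (K r)) \<le> (l + 2 * \<delta>) + 1"
      by (rule card_int_interval_le[of "K r" x "l + 2 * \<delta>"]; use * l0 \<delta> in auto)+
    then show ?thesis using \<delta> by (simp add: l_def)
  qed
  have sub: "\<Phi> ` H \<subseteq> Sigma {..<q} K" using q by (auto simp: \<Phi>_def K_def)
  have "real (card H) = (\<Sum>y\<in>\<Phi> ` H. real (card {h \<in> H. \<Phi> h = y}))"
    using sum.image_gen[OF finH, of "\<lambda>_. 1::nat" \<Phi>] by (simp flip: of_nat_sum)
  also have "\<dots> \<le> (\<Sum>y\<in>\<Phi> ` H. 2 * \<delta> / \<kappa> + 1)" by (intro sum_mono fibre)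
  also have "\<dots> = real (card (\<Phi> ` H)) * (2 * \<delta> / \<kappa> + 1)" by simp
  also have "\<dots> \<le> (real V * \<kappa> + 2 * real q) * (2 * \<delta> / \<kappa> + 1)"
  proof (rule mult_right_mono)
    have "card (\<Phi> ` H) \<le> card (Sigma {..<q} K)" using sub K by (intro card_mono finite_SigmaI) auto
    also have "\<dots> = (\<Sum>r<q. card (K r))" using K by (simp add: card_SigmaI)
    finally have "real (card (\<Phi> ` H)) \<le> (\<Sum>r<q. real (card (K r)))" by (simp flip: of_nat_sum)
    also have "\<dots> \<le> (\<Sum>r<q. real V * \<kappa> / real q + 2)" using K by (intro sum_mono) auto
    also have "\<dots> = real V * \<kappa> + 2 * real q" using q(1) by (simp add: field_simps)
    finally show "real (card (\<Phi> ` H)) \<le> real V * \<kappa> + 2 * real q" .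
  qed (use \<delta> \<kappa> in auto)
  finally show ?thesis .
qed

lemma close_pair:
  fixes H :: "nat set"
  assumes "H \<subseteq> {1..V}" "l > 0" "real V / real l + 1 < real (card H)"
  obtains h h' where "h \<in> H" "h' \<in> H" "h' < h" "h - h' < l"
proof -
  have "(\<lambda>h. h div l) ` H \<subseteq> {..V div l}" using subsetD[OF assms(1)] by (auto intro!: div_le_mono)
  then have "card ((\<lambda>h. h div l) ` H) \<le> V div l + 1" using card_mono[of "{..V div l}"] by fastforce
  also have "\<dots> < card H"
    using assms(3) of_nat_div_le_of_nat[of V l, where 'a=real] by linarith
  finally have "\<not> inj_on (\<lambda>h. h div l) H" by (intro pigeonhole)
  then obtain h h' where h: "h \<in> H" "h' \<in> H" "h \<noteq> h'" "h div l = h' div l" by (auto simp: inj_on_def)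
  have *: "h - h' < l" if "h div l = h' div l" for h h'
    using that assms(2) by (metis add_diff_cancel_left diff_le_self div_mult_mod_eq le_less_trans mod_less_divisor nat_minus_add_max nat_le_linear max_def diff_is_0_eq' diff_add_inverse2 diff_diff_left diff_commute diff_mono)
  show ?thesis using that h *[OF h(4)] *[OF h(4)[symmetric]] by (metis linorder_neqE_nat)
qed

text \<open>Differencing gives a proportion of order \<open>T = t\<^sup>2\<close> of all
  \<open>h\<close> for which \<open>2 * h * \<gamma>\<close> is close to an integer. Two of them are
  close together, and their difference \<open>q\<close> is a first, weak approximation. If this
  approximation were not as good as claimed, the multiples would drift around the circle and too few
  \<open>h\<close> could be near integers. Counting these \<open>h\<close>, instead of summing
  bounds for all linear sums, avoids logarithms.\<close>

lemma large_quadratic_sum_imp_near_fraction: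
  fixes \<gamma> t :: real
  assumes t: "0 < t" "t \<le> 1" and V: "768 / t ^ 4 \<le> real V"
    and large: "t * real V \<le> cmod (\<Sum>v=1..V. unit_exp (\<gamma> * (real v)\<^sup>2))"
  obtains q :: nat and a :: int where "1 \<le> q" "real q \<le> 32 / t\<^sup>2"
    "\<bar>real q * \<gamma> - of_int a\<bar> \<le> 4096 / (t ^ 6 * (real V)\<^sup>2)"
proof -
  define T where "T = t\<^sup>2"
  define I where "I = (\<lambda>h. cmod (\<Sum>u=1..V - h. unit_exp (2 * real h * \<gamma> * real u)))"
  \<comment> \<open>Linear sums below this threshold contribute at most a quarter of the required
    size; \<open>\<delta>\<close> is the matching distance \<open>1 / (2 * c)\<close>.\<close>
  define c where "c = T * real V / 8"
  define \<delta> where "\<delta> = 4 / (T * real V)"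
  define \<theta> where "\<theta> = 2 * \<gamma>"
  define H where "H = {h \<in> {1..V}. c \<le> I h}"
  have t2: "T \<le> 1" using t by (simp add: power_le_one T_def)
  have T0: "T > 0" using t by (simp add: T_def)
  have t4: "t ^ 4 = T * T" by (simp add: T_def flip: power_add)
  have t6: "t ^ 6 = T * T * T" by (simp add: T_def flip: power_add)
  have V4: "768 \<le> T * (T * real V)" using V T0 unfolding t4 by (simp add: pos_divide_le_eq mult_ac)
  also have "\<dots> \<le> 1 * (T * real V)" using t2 T0 by (intro mult_right_mono) auto
  finally have V2: "768 \<le> T * real V" by simp
  have "1 * (T * real V) \<le> 1 * (1 * real V)" using t2 T0 by (intro mult_mono) auto
  then have V0: "real V > 0" using V2 by linarith
  have c0: "c > 0" using V2 by (simp add: c_def)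
  have "(t * real V)\<^sup>2 \<le> (cmod (\<Sum>v=1..V. unit_exp (\<gamma> * (real v)\<^sup>2)))\<^sup>2"
    using large t by (intro power_mono) auto
  also have "\<dots> \<le> real V + 2 * (\<Sum>h=1..V. I h)" unfolding I_def by (rule cmod_quadratic_sum_squared_le)
  also have "(\<Sum>h=1..V. I h) \<le> (\<Sum>h=1..V. c + (if h \<in> H then real V else 0))"
  proof (rule sum_mono)
    fix h assume h: "h \<in> {1..V}"
    have "I h \<le> (\<Sum>u=1..V - h. 1)" unfolding I_def by (intro sum_norm_le) simp
    then have "I h \<le> real V" by simp
    then show "I h \<le> c + (if h \<in> H then real V else 0)" using h c0 by (auto simp: H_def)
  qed
  also have "\<dots> = real V * c + real (card H) * real V"
    by (simp add: sum.distrib sum.If_cases H_def Int_def)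
  finally have "real V * (T * real V) \<le> real V * (1 + 2 * (c + real (card H)))"
    by (simp add: power2_eq_square algebra_simps T_def)
  then have "T * real V \<le> 1 + 2 * (c + real (card H))" using V0 by simp
  then have cardH: "T * real V / 8 \<le> real (card H)" using V2 by (simp add: c_def)
  have HV: "H \<subseteq> {1..V}" by (auto simp: H_def)
  have nearH: "\<exists>n::int. \<bar>real h * \<theta> - of_int n\<bar> \<le> \<delta>" if "h \<in> H" for h
  proof -
    have "c \<le> cmod (\<Sum>u=1..V - h. unit_exp ((real h * \<theta>) * real u))"
      using that by (simp add: H_def I_def \<theta>_def mult_ac)
    from large_linear_sum_imp_near_int[OF c0 this] show ?thesis by (simp add: \<delta>_def c_def)
  qed
  \<comment> \<open>Blocks of this length number about \<open>T * V / 16\<close>, half the lower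
    bound for \<open>card H\<close>, so some block contains two elements of
    \<open>H\<close>.\<close>
  define l where "l = nat \<lceil>16 / T\<rceil>"
  have l: "16 / T \<le> real l" unfolding l_def by linarith
  have l0: "l > 0" unfolding l_def using T0 by simp
  have "real V / real l \<le> real V / (16 / T)" using l T0 l0 by (intro divide_left_mono mult_pos_pos) auto
  also have "\<dots> = T * real V / 16" by simp
  finally have "real V / real l + 1 < real (card H)" using cardH V2 by linarith
  then obtain h h' where h: "h \<in> H" "h' \<in> H" "h' < h" "h - h' < l" using close_pair[OF HV l0] by blast
  obtain n n' :: int where n: "\<bar>real h * \<theta> - of_int n\<bar> \<le> \<delta>" "\<bar>real h' * \<theta> - of_int n'\<bar> \<le> \<delta>"
    using nearH h by meson
  define q where "q = h - h'"
  define a where "a = n - n'"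
  define \<kappa> where "\<kappa> = \<bar>real q * \<theta> - of_int a\<bar>"
  have q0: "q > 0" using h by (simp add: q_def)
  have q: "real q \<le> 16 / T"
  proof -
    have "int q < \<lceil>16 / T\<rceil>" using h(4) unfolding q_def l_def by linarith
    then show ?thesis by (simp add: less_ceiling_iff)
  qed
  have "real q * \<theta> - of_int a = (real h * \<theta> - of_int n) - (real h' * \<theta> - of_int n')"
    using h(3) by (simp add: q_def a_def of_nat_diff algebra_simps)
  then have \<kappa>le: "\<kappa> \<le> 2 * \<delta>" unfolding \<kappa>_def using n by linarith
  have \<delta>0: "0 < \<delta>" using V2 by (simp add: \<delta>_def)
  have \<delta>1: "\<delta> \<le> 1 / 2" using V2 by (simp add: \<delta>_def field_simps)
  have \<delta>V: "\<delta> * real V = 4 / T" using V0 by (simp add: \<delta>_def)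
  have "\<kappa> \<le> 4096 / (t ^ 6 * (real V)\<^sup>2)"
  proof (cases "\<kappa> = 0")
    case False
    then have \<kappa>0: "\<kappa> > 0" by (simp add: \<kappa>_def)
    have "T * real V / 8 \<le> (real V * \<kappa> + 2 * real q) * (2 * \<delta> / \<kappa> + 1)"
      using card_near_int_multiples_le[OF HV nearH q0 \<kappa>_def[symmetric] \<kappa>0 _ \<delta>1] \<delta>0 cardH by linarith
    also have "\<dots> = 2 * (\<delta> * real V) + \<kappa> * real V + 4 * real q * \<delta> / \<kappa> + 2 * real q"
      using \<kappa>0 by (simp add: field_simps)
    also have "\<kappa> * real V \<le> 2 * (\<delta> * real V)" using \<kappa>le V0 by simp
    finally have "T * real V / 8 \<le> 4 * (4 / T) + 2 * (16 / T) + 4 * real q * \<delta> / \<kappa>"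
      using q unfolding \<delta>V by linarith
    \<comment> \<open>This is the hypothesis on \<open>V\<close>, as \<open>48 * 16 = 768\<close>.
      It absorbs all terms but the one with \<open>1 / \<kappa>\<close>, which therefore has to be
      large.\<close>
    moreover have "48 / T \<le> T * real V / 16" using V4 T0 by (simp add: pos_divide_le_eq mult_ac)
    moreover have "4 * (4 / T) + 2 * (16 / T) = 48 / T" by simp
    ultimately have "T * real V / 16 \<le> 4 * real q * \<delta> / \<kappa>" by linarith
    then have "\<kappa> * (T * real V) \<le> 64 * \<delta> * real q" using \<kappa>0 by (simp add: field_simps)
    also have "\<dots> \<le> 64 * \<delta> * (16 / T)" using q \<delta>0 by (intro mult_left_mono) auto
    also have "\<dots> = 4096 / (T * T * real V)" by (simp add: \<delta>_def)
    finally have "\<kappa> * (T * real V) * (T * T * real V) \<le> 4096" using V0 T0 by (simp add: field_simps)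
    moreover have "\<kappa> * (T * real V) * (T * T * real V) = \<kappa> * (t ^ 6 * (real V)\<^sup>2)"
      unfolding t6 by (simp add: power2_eq_square mult_ac)
    moreover have "t ^ 6 * (real V)\<^sup>2 > 0" using V0 t by simp
    ultimately show ?thesis by (simp add: pos_le_divide_eq)
  qed simp
  \<comment> \<open>The denominator doubles because \<open>\<theta> = 2 * \<gamma>\<close>.\<close>
  then show ?thesis using that[of "2 * q" a] q0 q by (simp add: \<kappa>_def \<theta>_def T_def mult_ac)
qed

section \<open>Positivity of the mean over squares\<close>

definition sq_mean :: "nat \<Rightarrow> nat \<Rightarrow> real \<Rightarrow> real" where
  "sq_mean Q V \<alpha> = (\<Sum>v=1..V. cos (2 * pi * (real ((Q * v)\<^sup>2) * \<alpha>))) / real V"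

lemma sq_mean_ge:
  assumes "V > 0" "\<And>v. v \<in> {1..V} \<Longrightarrow> c \<le> cos (2 * pi * (real ((Q * v)\<^sup>2) * \<alpha>))"
  shows "c \<le> sq_mean Q V \<alpha>"
proof -
  have "(\<Sum>v=1..V. c) \<le> (\<Sum>v=1..V. cos (2 * pi * (real ((Q * v)\<^sup>2) * \<alpha>)))"
    using assms(2) by (intro sum_mono) blast
  then show ?thesis using assms(1) by (simp add: sq_mean_def field_simps)
qed

text \<open>The Weyl bound at \<open>t = 1 / r ^ 3\<close>. The bound \<open>32 * r ^ 6\<close> for
  \<open>q\<close> is relaxed to the cube \<open>(4 * r\<^sup>2) ^ 3\<close>, the form needed by
  \<open>mertens_upper\<close>.\<close>

lemma sq_mean_le_imp_near_fraction:
  fixes r :: nat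
  assumes r: "r > 0" and V: "768 * real r ^ 12 \<le> real V"
    and neg: "sq_mean Q V \<alpha> \<le> - 1 / real r ^ 3"
  obtains q :: nat and a :: int where "1 \<le> q" "q \<le> (4 * r\<^sup>2) ^ 3"
    "\<bar>real (q * Q\<^sup>2) * \<alpha> - of_int a\<bar> \<le> 4096 * real r ^ 18 / (real V)\<^sup>2"
proof -
  define t where "t = 1 / real r ^ 3"
  define \<gamma> where "\<gamma> = real (Q\<^sup>2) * \<alpha>"
  have r1: "real r \<ge> 1" using r by simp
  have t: "0 < t" "t \<le> 1" using r1 by (auto simp: t_def)
  have V0: "real V > 0" using V r by (meson less_le_trans mult_pos_pos of_nat_0_less_iff zero_less_numeral zero_less_power)
  have tp: "1 / t ^ k = real r ^ (3 * k)" for k by (simp add: t_def power_one_over power_mult)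
  have "t * real V \<le> - (\<Sum>v=1..V. cos (2 * pi * (real ((Q * v)\<^sup>2) * \<alpha>)))"
    using neg V0 by (simp add: sq_mean_def t_def field_simps)
  also have "\<dots> = - Re (\<Sum>v=1..V. unit_exp (\<gamma> * (real v)\<^sup>2))"
    by (simp add: Re_unit_exp \<gamma>_def power_mult_distrib mult_ac)
  also have "\<dots> \<le> cmod (\<Sum>v=1..V. unit_exp (\<gamma> * (real v)\<^sup>2))"
    using abs_Re_le_cmod[of "\<Sum>v=1..V. unit_exp (\<gamma> * (real v)\<^sup>2)"] by linarith
  finally have large: "t * real V \<le> cmod (\<Sum>v=1..V. unit_exp (\<gamma> * (real v)\<^sup>2))" .
  have V': "768 / t ^ 4 \<le> real V" using V tp[of 4] by simp
  obtain q :: nat and a :: int where q: "1 \<le> q" "real q \<le> 32 / t\<^sup>2"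
    "\<bar>real q * \<gamma> - of_int a\<bar> \<le> 4096 / (t ^ 6 * (real V)\<^sup>2)"
    using large_quadratic_sum_imp_near_fraction[OF t V' large] .
  show ?thesis
  proof (rule that[of q a])
    have "real q \<le> 32 * real r ^ 6" using q(2) tp[of 2] by simp
    also have "\<dots> \<le> real ((4 * r\<^sup>2) ^ 3)" by (simp add: power_mult_distrib flip: power_mult)
    finally show "q \<le> (4 * r\<^sup>2) ^ 3" by (simp only: of_nat_le_iff)
    have "4096 / (t ^ 6 * (real V)\<^sup>2) = 4096 * (1 / t ^ 6) / (real V)\<^sup>2" by simp
    then show "\<bar>real (q * Q\<^sup>2) * \<alpha> - of_int a\<bar> \<le> 4096 * real r ^ 18 / (real V)\<^sup>2"
      using q(3) tp[of 6] by (simp add: \<gamma>_def mult_ac)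
  qed (use q in auto)
qed

text \<open>At such a point \<open>q * (Q i)\<^sup>2\<close> is a denominator all of whose primes
  are at most \<open>(4 * r\<^sup>2) ^ 3\<close>, so \<open>mertens_upper\<close> bounds the Euler
  product by \<open>16 * r\<^sup>2\<close>. The union over all scales in \<open>I\<close> costs
  nothing extra, since \<open>Z\<close> and the bounds on denominators and distances are common to
  them.\<close>

lemma sum_cmod_exp_sum_squared_le_level:
  fixes Q V :: "nat \<Rightarrow> nat" and r M :: nat
  assumes L: "L > 0" "\<And>p. prime p \<Longrightarrow> p \<le> R \<Longrightarrow> p dvd L"
    and P: "finite P" "P \<subseteq> {..<L}" "\<And>p. p \<in> P \<Longrightarrow> prime p \<and> R < p"
    and r: "r > 0"
    and QV: "\<And>i p. i \<in> I \<Longrightarrow> prime p \<Longrightarrow> p dvd Q i \<Longrightarrow> p \<le> (4 * r\<^sup>2) ^ 3"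
      "\<And>i. i \<in> I \<Longrightarrow> (Q i)\<^sup>2 \<le> M" "\<And>i. i \<in> I \<Longrightarrow> W \<le> V i"
    and W: "768 * real r ^ 12 \<le> real W" "524288 * real r ^ 24 * real M * (real R)\<^sup>2 < (real W)\<^sup>2"
  shows "ln (real R + 1) * (\<Sum>j | j < L \<and> (\<exists>i\<in>I. sq_mean (Q i) (V i) (real j / real L) \<le> - 1 / real r ^ 3).
      (cmod (exp_sum P L j))\<^sup>2) \<le> 16 * (real r)\<^sup>2 * (real L * real (card P))"
proof -
  define A where "A = {j. j < L \<and> (\<exists>i\<in>I. sq_mean (Q i) (V i) (real j / real L) \<le> - 1 / real r ^ 3)}"
  define Z where "Z = {p. prime p \<and> p \<le> (4 * r\<^sup>2) ^ 3}"
  define B where "B = 4096 * real r ^ 18 / (real W)\<^sup>2"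
  have W0: "real W > 0" using W(1) r by (meson less_le_trans mult_pos_pos of_nat_0_less_iff zero_less_numeral zero_less_power)
  have "ln (real R + 1) * (\<Sum>j\<in>A. (cmod (exp_sum P L j))\<^sup>2) \<le>
    (\<Prod>p\<in>Z. real p / (real p - 1)) * (real L * real (card P))"
  proof (rule sum_cmod_exp_sum_squared_le_near_fractions[OF L P, where M = "(4 * r\<^sup>2) ^ 3 * M" and B = B])
    fix j assume "j \<in> A"
    then obtain i where i: "i \<in> I" "sq_mean (Q i) (V i) (real j / real L) \<le> - 1 / real r ^ 3" by (auto simp: A_def)
    have "768 * real r ^ 12 \<le> real (V i)" using W(1) QV(3)[OF i(1)] by linarith
    then obtain q a where q: "1 \<le> q" "q \<le> (4 * r\<^sup>2) ^ 3"
      "\<bar>real (q * (Q i)\<^sup>2) * (real j / real L) - of_int a\<bar> \<le> 4096 * real r ^ 18 / (real (V i))\<^sup>2"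
      using sq_mean_le_imp_near_fraction[OF r _ i(2)] by blast
    show "\<exists>m (a::int). m \<le> (4 * r\<^sup>2) ^ 3 * M \<and> (\<forall>p. prime p \<longrightarrow> p dvd m \<longrightarrow> p \<in> Z) \<and>
          \<bar>real m * (real j / real L) - of_int a\<bar> \<le> B"
    proof (intro exI conjI allI impI)
      show "q * (Q i)\<^sup>2 \<le> (4 * r\<^sup>2) ^ 3 * M" using q(2) QV(2)[OF i(1)] by (rule mult_le_mono)
      fix p assume p: "prime p" "p dvd q * (Q i)\<^sup>2"
      then consider "p dvd q" | "p dvd Q i" by (metis prime_dvd_multD prime_dvd_power_nat)
      then have "p \<le> (4 * r\<^sup>2) ^ 3"
      proof cases
        case 1
        then show ?thesis using q(1,2) dvd_imp_le[of p q] by linarith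
      qed (use QV(1)[OF i(1) p(1)] in auto)
      then show "p \<in> Z" using p(1) by (simp add: Z_def)
    next
      have "(real W)\<^sup>2 \<le> (real (V i))\<^sup>2" using QV(3)[OF i(1)] by (intro power_mono) auto
      then have "4096 * real r ^ 18 / (real (V i))\<^sup>2 \<le> B"
        unfolding B_def using W0 by (intro divide_left_mono mult_pos_pos) auto
      then show "\<bar>real (q * (Q i)\<^sup>2) * (real j / real L) - of_int a\<bar> \<le> B" using q(3) by linarith
    qed
  next
    \<comment> \<open>The constant is \<open>2 * 64 * 4096\<close>.\<close>
    have "2 * real ((4 * r\<^sup>2) ^ 3 * M) * B * (real R)\<^sup>2 = 524288 * real r ^ 24 * real M * (real R)\<^sup>2 / (real W)\<^sup>2"
      by (simp add: B_def power_mult_distrib power_numeral_reduce field_simps)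
    then show "2 * real ((4 * r\<^sup>2) ^ 3 * M) * B * (real R)\<^sup>2 < 1" using W(2) W0 by simp
  qed (auto simp: A_def Z_def)
  also have "\<dots> \<le> (4 * real (4 * r\<^sup>2)) * (real L * real (card P))"
    unfolding Z_def using r by (intro mult_right_mono mertens_upper) auto
  finally show ?thesis by (simp add: A_def)
qed

text \<open>Raising \<open>n\<close> by one either keeps the old remainder as a new summand, when
  \<open>x\<close> is below the next threshold, or shows that the new, smaller remainder alone
  suffices. The summands can be integrated against the mass bounds of the levels.\<close>

lemma neg_le_dyadic_levels:
  fixes x :: real and s :: nat
  assumes "- 1 / real s ^ 3 \<le> x"
  shows "- x \<le> (\<Sum>k<n. if x \<le> - 1 / real (s * 2 ^ Suc k) ^ 3 then 1 / real (s * 2 ^ k) ^ 3 else 0)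
    + 1 / real (s * 2 ^ n) ^ 3"
proof (induction n)
  case (Suc n)
  let ?f = "\<lambda>k. if x \<le> - 1 / real (s * 2 ^ Suc k) ^ 3 then 1 / real (s * 2 ^ k) ^ 3 else 0"
  have nonneg: "0 \<le> sum ?f {..<n}" by (intro sum_nonneg) auto
  have nn: "0 \<le> 1 / real (s * 2 ^ Suc n) ^ 3" by simp
  show ?case
  proof (cases "x \<le> - 1 / real (s * 2 ^ Suc n) ^ 3")
    case True
    then have "sum ?f {..<Suc n} = sum ?f {..<n} + 1 / real (s * 2 ^ n) ^ 3" by simp
    then show ?thesis using Suc.IH nn by linarith
  next
    case False
    then have "sum ?f {..<Suc n} = sum ?f {..<n}" by simp
    moreover have "- x \<le> 1 / real (s * 2 ^ Suc n) ^ 3" using False by simp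
    ultimately show ?thesis using nonneg by linarith
  qed
qed (use assms in simp)

section \<open>Contribution near 0 and averaging over scales\<close>

lemma cos_ge_of_le_eighth:
  assumes "0 \<le> x" "x \<le> 1 / 8"
  shows "sqrt 2 / 2 \<le> cos (2 * pi * x)"
proof -
  have "pi * x \<le> pi * (1 / 8)" using assms by (intro mult_left_mono) auto
  then have "cos (pi / 4) \<le> cos (2 * pi * x)"
    using assms by (intro cos_monotone_0_pi_le) auto
  then show ?thesis by (simp add: cos_45)
qed

lemma sum_cmod_exp_sum_squared_near_0_ge:
  assumes L: "L > 0" and N: "N > 0" and P: "P \<subseteq> {..N}"
  shows "real L * (real (card P))\<^sup>2 / (16 * real N) \<le> (\<Sum>j | j < L \<and> 8 * N * j \<le> L. (cmod (exp_sum P L j))\<^sup>2)"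
proof -
  define J where "J = {j. j < L \<and> 8 * N * j \<le> L}"
  have finP: "finite P" using P finite_subset by blast
  have S: "(real (card P))\<^sup>2 / 2 \<le> (cmod (exp_sum P L j))\<^sup>2" if j: "j \<in> J" for j
  proof -
    have "(\<Sum>p\<in>P. sqrt 2 / 2) \<le> (\<Sum>p\<in>P. cos (2 * pi * (real p * (real j / real L))))"
    proof (intro sum_mono cos_ge_of_le_eighth)
      fix p assume "p \<in> P"
      then have "p * j \<le> N * j" using P by auto
      then have "8 * (p * j) \<le> 8 * (N * j)" by (rule mult_le_mono2)
      also have "\<dots> \<le> L" using j by (simp add: J_def mult_ac)
      finally have "8 * (p * j) \<le> L" .
      then have "real (8 * (p * j)) \<le> real L" by (rule of_nat_mono)
      then show "real p * (real j / real L) \<le> 1 / 8" using L by (simp add: field_simps)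
    qed simp
    also have "\<dots> = Re (exp_sum P L j)" by (simp add: exp_sum_def Re_unit_exp)
    also have "\<dots> \<le> cmod (exp_sum P L j)" by (rule complex_Re_le_cmod)
    finally have "(real (card P) * (sqrt 2 / 2))\<^sup>2 \<le> (cmod (exp_sum P L j))\<^sup>2" by (intro power_mono) auto
    then show ?thesis by (simp add: power_mult_distrib power_divide)
  qed
  have sub: "{..<L div (8 * N)} \<subseteq> J"
  proof
    fix j assume "j \<in> {..<L div (8 * N)}"
    then have "j \<le> L div (8 * N)" "j < L div (8 * N)" by auto
    moreover from this have "8 * N * j \<le> L" using N by (simp add: less_eq_div_iff_mult_less_eq mult.commute)
    moreover have "L div (8 * N) \<le> L" by (rule div_le_dividend)
    ultimately show "j \<in> J" unfolding J_def by (auto intro: less_le_trans)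
  qed
  \<comment> \<open>With this endpoint the count is the floor of \<open>L / (8 * N)\<close> plus 1,
    hence at least \<open>L / (8 * N)\<close>.\<close>
  have "L div (8 * N) \<in> J"
    using L N by (auto simp: J_def)
  then have sub': "insert (L div (8 * N)) {..<L div (8 * N)} \<subseteq> J" using sub by auto
  have finJ: "finite J" unfolding J_def by simp
  have "L div (8 * N) + 1 \<le> card J" using card_mono[OF finJ sub'] by simp
  then have "real (L div (8 * N)) + 1 \<le> real (card J)" by linarith
  moreover have "real L / real (8 * N) \<le> real (L div (8 * N)) + 1"
  proof -
    have "L < 8 * N + L div (8 * N) * (8 * N)" using N by (intro dividend_less_div_times) simp
    then have "real L < real (8 * N + L div (8 * N) * (8 * N))" by (simp only: of_nat_less_iff)
    also have "\<dots> = (real (L div (8 * N)) + 1) * real (8 * N)"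
      by (simp only: of_nat_add of_nat_mult distrib_right mult_1_left add.commute)
    finally show ?thesis using N by (simp add: pos_divide_le_eq)
  qed
  ultimately have "real L / real (8 * N) \<le> real (card J)" by linarith
  then have "real L / real (8 * N) * ((real (card P))\<^sup>2 / 2) \<le> real (card J) * ((real (card P))\<^sup>2 / 2)"
    by (rule mult_right_mono) simp
  also have "\<dots> = (\<Sum>j\<in>J. (real (card P))\<^sup>2 / 2)" by simp
  also have "\<dots> \<le> (\<Sum>j\<in>J. (cmod (exp_sum P L j))\<^sup>2)" by (intro sum_mono S)
  finally show ?thesis by (simp add: J_def)
qed

text \<open>The weighted sum over the grid of the \<open>K\<close> means is 0 by
  \<open>nosq\<close>. Near 0 every mean is at least \<open>1 / 2\<close>, a gain proportional to
  \<open>K\<close>. Very negative values cost only 1 per point in total, since by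
  \<open>hier\<close> at most one scale is affected, so this loss becomes small relative to
  \<open>K\<close>. Mildly negative values cost a fraction \<open>O(1 / s)\<close> of
  \<open>1 / ln R\<close> per scale, up to the remainder of the dyadic levels.\<close>

lemma prime_density_bound_of_no_square_differences:
  fixes Q V :: "nat \<Rightarrow> nat" and s K n M :: nat
  assumes L: "L > 0" "\<And>p. prime p \<Longrightarrow> p \<le> R \<Longrightarrow> p dvd L"
    and P: "finite P" "P \<subseteq> {..N}" "N < L" "\<And>p. p \<in> P \<Longrightarrow> prime p \<and> R < p"
    and s: "s > 0" and K: "K > 0" and N: "N > 0" and R: "R > 0"
    and QV: "\<And>i p. i \<in> {1..K} \<Longrightarrow> prime p \<Longrightarrow> p dvd Q i \<Longrightarrow> p \<le> (4 * s\<^sup>2) ^ 3"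
      "\<And>i. i \<in> {1..K} \<Longrightarrow> (Q i)\<^sup>2 \<le> M" "\<And>i. i \<in> {1..K} \<Longrightarrow> W \<le> V i"
      "\<And>i. i \<in> {1..K} \<Longrightarrow> (Q i * V i)\<^sup>2 \<le> N"
    and W: "768 * real (s * 2 ^ n) ^ 12 \<le> real W"
      "524288 * real (s * 2 ^ n) ^ 24 * real M * (real R)\<^sup>2 < (real W)\<^sup>2"
    and hier: "\<And>i i' \<alpha>. i \<in> {1..K} \<Longrightarrow> i' \<in> {1..K} \<Longrightarrow> i < i' \<Longrightarrow>
      sq_mean (Q i) (V i) \<alpha> \<le> - 1 / real s ^ 3 \<Longrightarrow> 0 \<le> sq_mean (Q i') (V i') \<alpha>"
    and nosq: "\<And>p q i v. p \<in> P \<Longrightarrow> q \<in> P \<Longrightarrow> i \<in> {1..K} \<Longrightarrow> v \<in> {1..V i} \<Longrightarrow>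
      \<not> int L dvd int p - int q + int ((Q i * v)\<^sup>2)"
    and ne: "P \<noteq> {}"
  shows "real K * real (card P) / (32 * real N) \<le>
    16 * (real s)\<^sup>2 / ln (real R + 1) + real K * (128 / (real s * ln (real R + 1)) + 1 / real (s * 2 ^ n) ^ 3)"
proof -
  define S where "S = (\<lambda>j. (cmod (exp_sum P L j))\<^sup>2)"
  define T where "T = (\<lambda>i j. sq_mean (Q i) (V i) (real j / real L))"
  define X where "X = real L * real (card P)"
  define lam where "lam = ln (real R + 1)"
  define J where "J = {j. j < L \<and> 8 * N * j \<le> L}"
  define Bad where "Bad = {j. j < L \<and> (\<exists>i\<in>{1..K}. T i j \<le> - 1 / real s ^ 3)}"
  define lev where "lev = (\<lambda>i k. {j. j < L \<and> T i j \<le> - 1 / real (s * 2 ^ k) ^ 3})"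
  \<comment> \<open>The dyadic majorant of the negative part of \<open>T i j\<close>, valid while
    \<open>T i j\<close> exceeds \<open>- 1 / s ^ 3\<close>.\<close>
  define g where "g = (\<lambda>i j. (\<Sum>k<n. if j \<in> lev i (Suc k) then 1 / real (s * 2 ^ k) ^ 3 else 0) + 1 / real (s * 2 ^ n) ^ 3)"
  have S0: "S j \<ge> 0" for j by (simp add: S_def)
  have lam0: "lam > 0" using R by (simp add: lam_def)
  have PL: "P \<subseteq> {..<L}" using P(2,3) by auto
  have W0: "real W > 0"
    using W(1) s by (meson less_le_trans mult_pos_pos of_nat_0_less_iff zero_less_numeral zero_less_power nat_0_less_mult_iff)
  have V0: "V i > 0" if "i \<in> {1..K}" for i using QV(3)[OF that] W0 by simp
  have sumS: "(\<Sum>j<L. S j) = X" unfolding S_def X_def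
    using L(1) P(1) PL by (rule sum_cmod_exp_sum_squared)
  have level: "lam * (\<Sum>j | j < L \<and> (\<exists>i\<in>I. T i j \<le> - 1 / real (s * 2 ^ k) ^ 3). S j) \<le> 16 * (real (s * 2 ^ k))\<^sup>2 * X"
    if I: "I \<subseteq> {1..K}" and k: "k \<le> n" for I k
    unfolding lam_def T_def S_def X_def
  proof (rule sum_cmod_exp_sum_squared_le_level[OF L P(1) PL P(4), where M = M and W = W])
    have le: "s \<le> s * 2 ^ k" "s * 2 ^ k \<le> s * 2 ^ n" using k by auto
    then have le': "real (s * 2 ^ k) \<le> real (s * 2 ^ n)" by (simp only: of_nat_le_iff)
    show "0 < s * 2 ^ k" using s by simp
    show "p \<le> (4 * (s * 2 ^ k)\<^sup>2) ^ 3" if "i \<in> I" "prime p" "p dvd Q i" for i p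
    proof -
      have "p \<le> (4 * s\<^sup>2) ^ 3" using QV(1) I that by blast
      also have "\<dots> \<le> (4 * (s * 2 ^ k)\<^sup>2) ^ 3" using le(1) by (intro power_mono mult_left_mono) auto
      finally show ?thesis .
    qed
    show "768 * real (s * 2 ^ k) ^ 12 \<le> real W"
    proof -
      have "real (s * 2 ^ k) ^ 12 \<le> real (s * 2 ^ n) ^ 12" using le' by (rule power_mono) (rule of_nat_0_le_iff)
      then show ?thesis using W(1) by linarith
    qed
    have "524288 * real (s * 2 ^ k) ^ 24 * real M * (real R)\<^sup>2 \<le> 524288 * real (s * 2 ^ n) ^ 24 * real M * (real R)\<^sup>2"
      using le' by (intro mult_right_mono mult_left_mono power_mono) auto
    then show "524288 * real (s * 2 ^ k) ^ 24 * real M * (real R)\<^sup>2 < (real W)\<^sup>2" using W(2) by linarith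
  qed (use I QV in auto)
  have Bad: "lam * (\<Sum>j\<in>Bad. S j) \<le> 16 * (real s)\<^sup>2 * X"
    using level[of "{1..K}" 0] by (simp add: Bad_def)
  have lev: "lam * (\<Sum>j\<in>lev i k. S j) \<le> 16 * (real (s * 2 ^ k))\<^sup>2 * X" if "i \<in> {1..K}" "k \<le> n" for i k
    using level[of "{i}" k] that by (simp add: lev_def)
  have gsum: "lam * (\<Sum>j<L. S j * g i j) \<le> (128 / real s + lam / real (s * 2 ^ n) ^ 3) * X" if i: "i \<in> {1..K}" for i
  proof -
    have X0: "X \<ge> 0" by (simp add: X_def)
    have "(\<Sum>j<L. S j * g i j) = (\<Sum>k<n. \<Sum>j<L. S j * (if j \<in> lev i (Suc k) then 1 / real (s * 2 ^ k) ^ 3 else 0))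
        + (\<Sum>j<L. S j * (1 / real (s * 2 ^ n) ^ 3))"
      unfolding g_def distrib_left sum.distrib sum_distrib_left by (subst sum.swap) (rule refl)
    also have "(\<Sum>j<L. S j * (1 / real (s * 2 ^ n) ^ 3)) = X / real (s * 2 ^ n) ^ 3"
      unfolding sum_distrib_right[symmetric] sumS by simp
    also have "(\<Sum>k<n. \<Sum>j<L. S j * (if j \<in> lev i (Suc k) then 1 / real (s * 2 ^ k) ^ 3 else 0)) =
        (\<Sum>k<n. 1 / real (s * 2 ^ k) ^ 3 * (\<Sum>j\<in>lev i (Suc k). S j))"
    proof (rule sum.cong[OF refl])
      fix k
      have "(\<Sum>j<L. S j * (if j \<in> lev i (Suc k) then 1 / real (s * 2 ^ k) ^ 3 else 0)) =
          (\<Sum>j\<in>lev i (Suc k). S j * (1 / real (s * 2 ^ k) ^ 3))"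
        by (rule sum.mono_neutral_cong_right) (auto simp: lev_def)
      then show "(\<Sum>j<L. S j * (if j \<in> lev i (Suc k) then 1 / real (s * 2 ^ k) ^ 3 else 0)) =
          1 / real (s * 2 ^ k) ^ 3 * (\<Sum>j\<in>lev i (Suc k). S j)"
        by (simp only: sum_distrib_right mult.commute)
    qed
    finally have "lam * (\<Sum>j<L. S j * g i j) =
        (\<Sum>k<n. 1 / real (s * 2 ^ k) ^ 3 * (lam * (\<Sum>j\<in>lev i (Suc k). S j))) + lam * X / real (s * 2 ^ n) ^ 3"
      by (simp add: distrib_left sum_distrib_left mult_ac)
    \<comment> \<open>The mass at a level grows like \<open>4 ^ k\<close> and the height decreases
      like \<open>8 ^ k\<close>, so a geometric series with ratio \<open>1 / 2\<close>
      remains.\<close>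
    also have "(\<Sum>k<n. 1 / real (s * 2 ^ k) ^ 3 * (lam * (\<Sum>j\<in>lev i (Suc k). S j))) \<le>
        (\<Sum>k<n. 1 / real (s * 2 ^ k) ^ 3 * (16 * (real (s * 2 ^ Suc k))\<^sup>2 * X))"
      using i by (intro sum_mono mult_left_mono lev) auto
    also have "\<dots> = (\<Sum>k<n. 64 * X / real s * (1 / 2) ^ k)"
    proof (rule sum.cong[OF refl])
      fix k
      have "(16 * (real (s * 2 ^ Suc k))\<^sup>2 * X) = 64 * X * (real (s * 2 ^ k))\<^sup>2" by (simp add: power_mult_distrib)
      then have "1 / real (s * 2 ^ k) ^ 3 * (16 * (real (s * 2 ^ Suc k))\<^sup>2 * X) = 64 * X / real (s * 2 ^ k)"
        using s by (simp add: power3_eq_cube power2_eq_square)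
      then show "1 / real (s * 2 ^ k) ^ 3 * (16 * (real (s * 2 ^ Suc k))\<^sup>2 * X) = 64 * X / real s * (1 / 2) ^ k"
        by (simp add: power_one_over)
    qed
    also have "\<dots> = 64 * X / real s * (\<Sum>k<n. (1 / 2) ^ k)" by (simp add: sum_distrib_left)
    also have "\<dots> \<le> 64 * X / real s * 2"
    proof (rule mult_left_mono)
      have "(\<Sum>k<n. (1 / 2 :: real) ^ k) \<le> (\<Sum>k. (1 / 2) ^ k)" by (intro sum_le_suminf summable_geometric) auto
      then show "(\<Sum>k<n. (1 / 2 :: real) ^ k) \<le> 2" by (subst (asm) suminf_geometric) auto
    qed (use X0 in simp)
    finally show ?thesis by (simp add: algebra_simps)
  qed
  \<comment> \<open>For \<open>j\<close> in \<open>J\<close> all means are positive and the two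
    losses are harmless. Otherwise the scales with very negative mean, at most one for each
    \<open>j\<close>, are charged to \<open>Bad\<close> with the trivial bound \<open>-1\<close>,
    and the others to \<open>g\<close>.\<close>
  have pointwise: "(real K / 2) * (if j \<in> J then 1 else 0) - (if j \<in> Bad then 1 else 0) - (\<Sum>i=1..K. g i j) \<le> (\<Sum>i=1..K. T i j)"
    if j: "j < L" for j
  proof -
    have g0: "g i j \<ge> 0" for i unfolding g_def by (intro add_nonneg_nonneg sum_nonneg) auto
    show ?thesis
    proof (cases "j \<in> J")
      case True
      have "1 / 2 \<le> T i j" if i: "i \<in> {1..K}" for i
        unfolding T_def
      proof (rule sq_mean_ge[OF V0[OF i]])
        fix v assume v: "v \<in> {1..V i}"
        have "(Q i * v)\<^sup>2 \<le> (Q i * V i)\<^sup>2" using v by (intro power_mono mult_left_mono) auto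
        then have "(Q i * v)\<^sup>2 \<le> N" using QV(4)[OF i] by linarith
        then have "8 * (Q i * v)\<^sup>2 * j \<le> 8 * N * j" by (intro mult_right_mono mult_left_mono) auto
        also have "\<dots> \<le> L" using True by (simp add: J_def)
        finally have "real (8 * (Q i * v)\<^sup>2 * j) \<le> real L" by (rule of_nat_mono)
        then have "real ((Q i * v)\<^sup>2) * (real j / real L) \<le> 1 / 8" using L(1) by (simp add: field_simps)
        then have "sqrt 2 / 2 \<le> cos (2 * pi * (real ((Q i * v)\<^sup>2) * (real j / real L)))"
          by (intro cos_ge_of_le_eighth) auto
        moreover have "1 \<le> sqrt 2" by simp
        ultimately show "1 / 2 \<le> cos (2 * pi * (real ((Q i * v)\<^sup>2) * (real j / real L)))" by linarith
      qed
      then have "(\<Sum>i=1..K. 1 / 2) \<le> (\<Sum>i=1..K. T i j)" by (rule sum_mono)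
      moreover have "0 \<le> (\<Sum>i=1..K. g i j)" using g0 by (intro sum_nonneg) auto
      ultimately show ?thesis using True by auto
    next
      case False
      define b where "b = (\<lambda>i. if T i j \<le> - 1 / real s ^ 3 then 1 else (0::real))"
      have T1: "- b i - g i j \<le> T i j" if i: "i \<in> {1..K}" for i
      proof (cases "T i j \<le> - 1 / real s ^ 3")
        case True
        have "- 1 \<le> T i j" unfolding T_def by (rule sq_mean_ge[OF V0[OF i]]) simp
        then show ?thesis using True g0[of i] by (simp add: b_def)
      next
        case False
        then have "- T i j \<le> g i j"
          using neg_le_dyadic_levels[of s "T i j" n] j by (simp add: g_def lev_def)
        then show ?thesis using False by (simp add: b_def)
      qed
      have "(\<Sum>i=1..K. b i) \<le> (if j \<in> Bad then 1 else 0)"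
      proof (cases "j \<in> Bad")
        case True
        then obtain i0 where i0: "i0 \<in> {1..K}" "T i0 j \<le> - 1 / real s ^ 3" by (auto simp: Bad_def)
        have neg: "\<not> 0 \<le> T i j" if "T i j \<le> - 1 / real s ^ 3" for i
        proof -
          have "- 1 / real s ^ 3 < 0" using s by simp
          then show ?thesis using that by linarith
        qed
        have "b i = 0" if i: "i \<in> {1..K} - {i0}" for i
        proof (rule ccontr)
          assume "b i \<noteq> 0"
          then have Ti: "T i j \<le> - 1 / real s ^ 3" by (simp add: b_def split: if_splits)
          show False
          proof (cases "i < i0")
            case True
            then show False using hier[of i i0] i i0 Ti neg[of i0] by (auto simp: T_def)
          next
            case False
            then show False using hier[of i0 i] i i0 Ti neg[of i] by (auto simp: T_def)
          qed
        qed
        then have "(\<Sum>i=1..K. b i) = b i0" using i0 by (subst sum.remove[of _ i0]) auto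
        then show ?thesis using True by (simp add: b_def)
      next
        case False
        then have "b i = 0" if "i \<in> {1..K}" for i using that j by (auto simp: Bad_def b_def)
        then show ?thesis by simp
      qed
      moreover have "(\<Sum>i=1..K. - b i - g i j) \<le> (\<Sum>i=1..K. T i j)" by (intro sum_mono T1)
      ultimately show ?thesis using False by (simp add: sum_subtractf sum_negf)
    qed
  qed
  have zero: "(\<Sum>j<L. S j * T i j) = 0" if i: "i \<in> {1..K}" for i
  proof -
    have "(\<Sum>j<L. S j * T i j) = (\<Sum>v=1..V i. \<Sum>j<L. S j * cos (2 * pi * (real ((Q i * v)\<^sup>2) * (real j / real L)))) / real (V i)"
      unfolding T_def sq_mean_def sum_divide_distrib[symmetric] times_divide_eq_right sum_distrib_left
      by (subst sum.swap) (rule refl)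
    also have "(\<Sum>v=1..V i. \<Sum>j<L. S j * cos (2 * pi * (real ((Q i * v)\<^sup>2) * (real j / real L)))) = 0"
    proof (rule sum.neutral, rule ballI)
      fix v assume "v \<in> {1..V i}"
      then show "(\<Sum>j<L. S j * cos (2 * pi * (real ((Q i * v)\<^sup>2) * (real j / real L)))) = 0"
        using sum_cmod_exp_sum_squared_cos_eq_0[OF L(1), of P "int ((Q i * v)\<^sup>2)"] nosq i
        unfolding S_def of_int_of_nat_eq by blast
    qed
    finally show ?thesis by simp
  qed
  have "(\<Sum>j<L. S j * ((real K / 2) * (if j \<in> J then 1 else 0) - (if j \<in> Bad then 1 else 0) - (\<Sum>i=1..K. g i j))) \<le>
      (\<Sum>j<L. S j * (\<Sum>i=1..K. T i j))"
    by (intro sum_mono mult_left_mono pointwise S0) auto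
  also have "\<dots> = (\<Sum>i=1..K. \<Sum>j<L. S j * T i j)" unfolding sum_distrib_left by (rule sum.swap)
  also have "\<dots> = 0" using zero by (intro sum.neutral) blast
  finally have "(\<Sum>j<L. S j * ((real K / 2) * (if j \<in> J then 1 else 0))) \<le>
      (\<Sum>j<L. S j * (if j \<in> Bad then 1 else 0)) + (\<Sum>j<L. S j * (\<Sum>i=1..K. g i j))"
    by (simp add: right_diff_distrib sum_subtractf)
  also have "(\<Sum>j<L. S j * (if j \<in> Bad then 1 else 0)) = (\<Sum>j\<in>Bad. S j)"
    by (rule sum.mono_neutral_cong_right) (auto simp: Bad_def)
  also have "(\<Sum>j<L. S j * (\<Sum>i=1..K. g i j)) = (\<Sum>i=1..K. \<Sum>j<L. S j * g i j)"
    unfolding sum_distrib_left by (rule sum.swap)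
  also have "(\<Sum>j<L. S j * ((real K / 2) * (if j \<in> J then 1 else 0))) = (\<Sum>j\<in>J. S j * (real K / 2))"
    by (rule sum.mono_neutral_cong_right) (auto simp: J_def)
  also have "\<dots> = real K / 2 * (\<Sum>j\<in>J. S j)" by (simp add: sum_distrib_left mult.commute)
  finally have main: "real K / 2 * (\<Sum>j\<in>J. S j) \<le> (\<Sum>j\<in>Bad. S j) + (\<Sum>i=1..K. \<Sum>j<L. S j * g i j)" .
  have "real K / 2 * (X * real (card P) / (16 * real N)) \<le> real K / 2 * (\<Sum>j\<in>J. S j)"
    using sum_cmod_exp_sum_squared_near_0_ge[OF L(1) N P(2)]
    by (intro mult_left_mono) (auto simp: X_def J_def S_def power2_eq_square)
  also note main
  also have "(\<Sum>j\<in>Bad. S j) \<le> 16 * (real s)\<^sup>2 * X / lam" using Bad lam0 by (simp add: field_simps)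
  also have "(\<Sum>i=1..K. \<Sum>j<L. S j * g i j) \<le> (\<Sum>i=1..K. (128 / real s + lam / real (s * 2 ^ n) ^ 3) * X / lam)"
    using gsum lam0 by (intro sum_mono) (simp add: pos_le_divide_eq mult.commute)
  also have "16 * (real s)\<^sup>2 * X / lam + (\<Sum>i=1..K. (128 / real s + lam / real (s * 2 ^ n) ^ 3) * X / lam) =
      X * (16 * (real s)\<^sup>2 / lam + real K * (128 / (real s * lam) + 1 / real (s * 2 ^ n) ^ 3))"
    using lam0 by (simp add: add_divide_distrib distrib_left distrib_right mult_ac)
  finally have "X * (real K * real (card P) / (32 * real N)) \<le>
      X * (16 * (real s)\<^sup>2 / lam + real K * (128 / (real s * lam) + 1 / real (s * 2 ^ n) ^ 3))"
    by (simp add: mult_ac)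
  moreover have "X > 0" using L(1) ne P(1) by (simp add: X_def card_gt_0_iff)
  ultimately show ?thesis unfolding lam_def by (rule mult_left_le_imp_le)
qed

text \<open>The denominator \<open>q\<close> found at scale \<open>i\<close> divides
  \<open>F\<close>, so the additional factor \<open>F ^ (2 * (i' - i))\<close> at the later scale
  clears it. The approximation error has size \<open>1 / V\<^sup>2\<close> for the earlier, longer
  range \<open>V\<close>, and the ratio of the ranges is a power of \<open>Y\<close>. Hence even the
  largest \<open>v\<^sup>2\<close> at the later scale leaves a distance of at most
  \<open>1 / 4\<close> to an integer, where the cosine is nonnegative.\<close>

lemma sq_mean_nonneg_of_earlier_neg:
  fixes s F W K i i' :: nat and \<alpha> :: real
  defines "Y \<equiv> 128 * s ^ 9 * F"
  assumes s: "s > 0" and F: "F > 0" "\<And>q. 1 \<le> q \<Longrightarrow> q \<le> (4 * s\<^sup>2) ^ 3 \<Longrightarrow> q dvd F"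
    and i: "i < i'" "i' \<le> K" and W: "768 * real s ^ 12 \<le> real W"
    and neg: "sq_mean (F ^ i) (W * Y ^ (K - i)) \<alpha> \<le> - 1 / real s ^ 3"
  shows "0 \<le> sq_mean (F ^ i') (W * Y ^ (K - i')) \<alpha>"
proof -
  define V where "V = W * Y ^ (K - i)"
  define V' where "V' = W * Y ^ (K - i')"
  define d where "d = i' - i"
  have Y0: "Y > 0" using s F by (simp add: Y_def)
  have W0: "W > 0" using W s by (metis less_le_not_le mult_pos_pos of_nat_0_less_iff order_less_le_trans zero_less_numeral zero_less_power)
  have V0: "V' > 0" using W0 Y0 by (simp add: V'_def)
  have VV': "V = V' * Y ^ d" using i by (simp add: V_def V'_def d_def power_add[symmetric] mult.assoc)
  have "W \<le> V" using Y0 by (simp add: V_def)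
  then have "768 * real s ^ 12 \<le> real V" using W by linarith
  then obtain q :: nat and a :: int where q: "1 \<le> q" "q \<le> (4 * s\<^sup>2) ^ 3"
    "\<bar>real (q * (F ^ i)\<^sup>2) * \<alpha> - of_int a\<bar> \<le> 4096 * real s ^ 18 / (real V)\<^sup>2"
    using sq_mean_le_imp_near_fraction[OF s _ neg] unfolding V_def by blast
  have "q dvd F ^ (2 * d)" using F(2)[OF q(1,2)] i by (intro dvd_trans[OF _ dvd_power]) (auto simp: d_def)
  then obtain c where c: "F ^ (2 * d) = q * c" by (auto simp: dvd_def)
  have "i' = i + d" using i by (simp add: d_def)
  then have "(F ^ i')\<^sup>2 = F ^ (2 * d) * (F ^ i)\<^sup>2"
    by (simp add: power_mult[symmetric] power_add[symmetric] algebra_simps)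
  then have Fi': "(F ^ i')\<^sup>2 = c * (q * (F ^ i)\<^sup>2)" unfolding c by (simp only: mult_ac)
  \<comment> \<open>The definition of \<open>Y\<close> is made for this:
    \<open>128\<^sup>2 = 4 * 4096\<close>.\<close>
  have Yd: "4 * (4096 * s ^ 18) * F ^ (2 * d) \<le> Y ^ (2 * d)"
  proof -
    have "4 * (4096 * s ^ 18) = (128 * s ^ 9) ^ 2" by (simp add: power_mult_distrib flip: power_mult)
    also have "\<dots> \<le> (128 * s ^ 9) ^ (2 * d)" using s i by (intro power_increasing) (auto simp: d_def)
    finally have "4 * (4096 * s ^ 18) \<le> (128 * s ^ 9) ^ (2 * d)" .
    then have "4 * (4096 * s ^ 18) * F ^ (2 * d) \<le> (128 * s ^ 9) ^ (2 * d) * F ^ (2 * d)" by (rule mult_le_mono1)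
    also have "\<dots> = Y ^ (2 * d)" unfolding Y_def by (rule power_mult_distrib[symmetric])
    finally show ?thesis .
  qed
  define m where "m = int c * a"
  have "\<bar>real ((F ^ i')\<^sup>2) * \<alpha> - of_int m\<bar> = real c * \<bar>real (q * (F ^ i)\<^sup>2) * \<alpha> - of_int a\<bar>"
  proof -
    have "real ((F ^ i')\<^sup>2) * \<alpha> - of_int m = real c * (real (q * (F ^ i)\<^sup>2) * \<alpha> - of_int a)"
      unfolding Fi' m_def of_nat_mult of_int_mult of_int_of_nat_eq by (simp add: right_diff_distrib mult.assoc)
    then show ?thesis by (simp only: abs_mult abs_of_nat)
  qed
  also have "\<dots> \<le> real c * (4096 * real s ^ 18 / (real V)\<^sup>2)" by (intro mult_left_mono q) auto
  also have "\<dots> \<le> real (F ^ (2 * d)) * (4096 * real s ^ 18 / (real V)\<^sup>2)"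
  proof (intro mult_right_mono)
    have "c \<le> F ^ (2 * d)" unfolding c using q(1) by simp
    then show "real c \<le> real (F ^ (2 * d))" by (rule of_nat_mono)
  qed simp
  also have "\<dots> = real (4 * (4096 * s ^ 18) * F ^ (2 * d)) / (4 * (real V)\<^sup>2)" by simp
  also have "\<dots> \<le> real (Y ^ (2 * d)) / (4 * (real V)\<^sup>2)" using Yd by (intro divide_right_mono of_nat_mono) auto
  also have "\<dots> = 1 / (4 * (real V')\<^sup>2)"
    using Y0 V0 by (simp add: VV' power_mult_distrib power_mult[symmetric] mult.commute)
  finally have near: "\<bar>real ((F ^ i')\<^sup>2) * \<alpha> - of_int m\<bar> \<le> 1 / (4 * (real V')\<^sup>2)" .
  show ?thesis unfolding V'_def[symmetric]
  proof (rule sq_mean_ge[OF V0])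
    fix v assume v: "v \<in> {1..V'}"
    define x where "x = real ((F ^ i' * v)\<^sup>2) * \<alpha> - of_int (m * (int v)\<^sup>2)"
    have "x = (real v)\<^sup>2 * (real ((F ^ i')\<^sup>2) * \<alpha> - of_int m)"
      by (simp add: x_def power_mult_distrib algebra_simps)
    then have "\<bar>x\<bar> = (real v)\<^sup>2 * \<bar>real ((F ^ i')\<^sup>2) * \<alpha> - of_int m\<bar>" by (simp only: abs_mult abs_power2)
    also have "\<dots> \<le> (real V')\<^sup>2 * (1 / (4 * (real V')\<^sup>2))" using v near by (intro mult_mono power_mono) auto
    also have "\<dots> = 1 / 4" using V0 by simp
    finally have "\<bar>2 * pi * x\<bar> \<le> pi / 2" by (simp add: abs_mult)
    then have "0 \<le> cos (2 * pi * x)" by (intro cos_ge_zero) linarith+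
    also have "cos (2 * pi * x) = cos (2 * pi * (real ((F ^ i' * v)\<^sup>2) * \<alpha>))"
      using unit_exp_add_of_int[of x "m * (int v)\<^sup>2"] unfolding x_def Re_unit_exp[symmetric] by simp
    finally show "0 \<le> cos (2 * pi * (real ((F ^ i' * v)\<^sup>2) * \<alpha>))" .
  qed
qed

section \<open>Choice of parameters and contradiction\<close>

lemma card_primes_between_ge:
  fixes n B N :: nat
  assumes n: "n > 0" and N: "even N" "2 ^ (48 * n) \<le> N" "ln (real N) \<le> 36 * real n"
    and B: "B \<le> 2 * 2 ^ (3 * n)"
  shows "real N / 144 \<le> real n * real (card {p. prime p \<and> B < p \<and> p \<le> N})"
proof -
  define P where "P = {p. prime p \<and> B < p \<and> p \<le> N}"
  obtain h where h: "N = 2 * h" using N(1) by blast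
  have N0: "N > 0" using N(2) by (metis gr0I not_exp_less_eq_0_int of_nat_0 leD zero_less_numeral zero_less_power)
  have "{p. prime p \<and> p \<le> N} \<subseteq> P \<union> {1..B}" by (auto simp: P_def prime_gt_0_nat Suc_le_eq not_less)
  then have "card {p. prime p \<and> p \<le> N} \<le> card (P \<union> {1..B})" by (intro card_mono) (auto simp: P_def)
  also have "\<dots> \<le> card P + B" using card_Un_le[of P "{1..B}"] by simp
  finally have cP: "real (card {p. prime p \<and> p \<le> N}) \<le> real (card P) + real B" by simp
  have "ln (4 :: real) = 2 * ln 2" using ln_realpow[of 2 2] by simp
  then have "(real N - 1) * ln 2 = real h * ln 4 - ln 2" by (simp add: h algebra_simps)
  also have "\<dots> \<le> real (card {p. prime p \<and> p \<le> N}) * ln (real N)"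
    using chebyshev_lower[of h] N0 by (simp add: h)
  also have "\<dots> \<le> (real (card P) + real B) * (36 * real n)"
    using cP N N0 by (intro mult_mono) auto
  finally have "(real N - 1) * ln 2 \<le> (real (card P) + real B) * (36 * real n)" .
  moreover have "(real N - 1) * (1 / 2) \<le> (real N - 1) * ln 2"
    using N0 ln2_ge_two_thirds by (intro mult_left_mono) auto
  ultimately have "(real N - 1) * (1 / 2) \<le> (real (card P) + real B) * (36 * real n)" by linarith
  then have 1: "real N / 2 - 1 / 2 \<le> 36 * (real n * real (card P)) + 36 * (real n * real B)"
    by (simp add: algebra_simps)
  \<comment> \<open>Discarding the primes up to \<open>B\<close> costs at most a constant times
    \<open>e\<close>, negligible against \<open>N \<ge> 2 ^ (48 * n)\<close>. A quarter of
    \<open>N\<close> is left, and dividing by 36 gives the constant 144.\<close>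
  define e :: nat where "e = 2 ^ (4 * n)"
  have "n * B \<le> 2 ^ n * (2 * 2 ^ (3 * n))" using B less_exp[of n] by (intro mult_le_mono) auto
  also have "\<dots> = 2 * e" by (simp add: e_def flip: power_add)
  finally have nB: "n * B \<le> 2 * e" .
  have "1024 * e = 2 ^ (10 + 4 * n)" by (simp add: e_def power_add)
  also have "\<dots> \<le> 2 ^ (48 * n)" using n by (intro power_increasing) auto
  finally have "1024 * e \<le> N" using N(2) by (rule order_trans)
  moreover have "1 \<le> e" by (simp add: e_def)
  moreover have "4 * (36 * b + 1) \<le> N" if "1024 * e \<le> N" "1 \<le> e" "b \<le> 2 * e" for b
    using that by simp
  ultimately have "4 * (36 * (n * B) + 1) \<le> N" using nB by blast
  then have "real (4 * (36 * (n * B) + 1)) \<le> real N" by (simp only: of_nat_le_iff)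
  then have "36 * (real n * real B) + 1 \<le> real N / 4" by simp
  then show ?thesis using 1 unfolding P_def[symmetric] by linarith
qed

theorem theorem2:
  "infinite {(p :: nat, q :: nat). prime p \<and> prime q \<and> p \<noteq> q \<and>
     (\<exists>u :: int. u \<ge> 1 \<and> int p - int q = u ^ 2)}"
proof
  assume fin: "finite {(p :: nat, q :: nat). prime p \<and> prime q \<and> p \<noteq> q \<and>
     (\<exists>u :: int. u \<ge> 1 \<and> int p - int q = u ^ 2)}" (is "finite ?D")
  obtain N0 where N0: "\<And>x. x \<in> fst ` ?D \<Longrightarrow> x \<le> N0"
    using finite_nat_set_iff_bounded_le[of "fst ` ?D"] fin by blast
  \<comment> \<open>The final inequality is between \<open>1 / 4608\<close> and
    \<open>66 / s\<close>.\<close>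
  obtain s :: nat where s: "1000000 \<le> s" by blast
  then have s0: "s > 0" by simp
  \<comment> \<open>Makes the loss \<open>16 * s\<^sup>2 / lam\<close> from the very negative values
    equal to \<open>2 / (s * lam)\<close> per scale.\<close>
  define K where "K = 8 * s ^ 3"
  define F :: nat where "F = fact ((4 * s\<^sup>2) ^ 3)"
  define Y where "Y = 128 * s ^ 9 * F"
  define C where "C = 524288 * s ^ 24 * (F ^ K)\<^sup>2 + 768 * s ^ 12"
  \<comment> \<open>Chosen after \<open>s\<close>, \<open>K\<close>, \<open>F\<close> and
    \<open>Y\<close>, so that all of them are negligible against powers \<open>2 ^ n\<close>. The
    other sizes are powers of \<open>2 ^ n\<close> with fixed exponents:
    \<open>W\<^sup>2 = 2 ^ (48 * n)\<close> has to exceed about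
    \<open>2 ^ (24 * n) * R\<^sup>2 = 2 ^ (30 * n)\<close>.\<close>
  define n where "n = C + N0 + K * (F * Y) + 1"
  define W :: nat where "W = 2 ^ (24 * n)"
  define R :: nat where "R = 2 ^ (3 * n)"
  define N where "N = (W * (F * Y) ^ K)\<^sup>2"
  \<comment> \<open>A factorial is divisible by all primes up to \<open>R\<close>. Since
    \<open>L > 2 * N\<close>, the congruences modulo \<open>L\<close> that occur below are
    equalities.\<close>
  define L :: nat where "L = fact (2 * N + 1)"
  define B where "B = max R N0"
  define P where "P = {p. prime p \<and> B < p \<and> p \<le> N}"
  define Q where "Q = (\<lambda>i. F ^ i)"
  define V where "V = (\<lambda>i. W * Y ^ (K - i))"
  have F0: "F > 0" by (simp add: F_def)
  have F_dvd: "q dvd F" if "1 \<le> q" "q \<le> (4 * s\<^sup>2) ^ 3" for q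
    unfolding F_def using that by (intro dvd_fact) auto
  have Y0: "Y > 0" using s0 F0 by (simp add: Y_def)
  have K0: "K > 0" using s0 by (simp add: K_def)
  have n0: "n > 0" by (simp add: n_def)
  have n2: "n < 2 ^ n" by (rule less_exp)
  have C_n: "524288 * s ^ 24 * (F ^ K)\<^sup>2 < 2 ^ n" "768 * s ^ 12 \<le> 2 ^ n"
  proof -
    have "524288 * s ^ 24 * (F ^ K)\<^sup>2 < n" "768 * s ^ 12 \<le> n" by (auto simp: n_def C_def)
    then show "524288 * s ^ 24 * (F ^ K)\<^sup>2 < 2 ^ n" "768 * s ^ 12 \<le> 2 ^ n" using n2 by linarith+
  qed
  have R0: "R > 0" by (simp add: R_def)
  have WN: "2 ^ (48 * n) \<le> N"
  proof -
    have "2 ^ (48 * n) = W\<^sup>2" by (simp add: W_def flip: power_mult)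
    also have "\<dots> \<le> N" unfolding N_def using F0 Y0 by (intro power_mono) auto
    finally show ?thesis .
  qed
  have Npos: "N > 0" using F0 Y0 by (simp add: N_def W_def)
  have L_gt: "2 * N < L" using fact_ge_self[of "2 * N + 1"] unfolding L_def by linarith
  \<comment> \<open>The main part is \<open>48 * ln 2 \<le> 33.4\<close> times \<open>n\<close>; the
    fixed factor \<open>(F * Y) ^ (2 * K)\<close> adds at most \<open>2 * n\<close>.\<close>
  have lnN: "ln (real N) \<le> 36 * real n"
  proof -
    have "ln (real N) = 2 * (24 * real n * ln 2 + real K * ln (real (F * Y)))"
      using F0 Y0 by (simp add: N_def W_def ln_realpow ln_mult)
    also have "\<dots> \<le> 2 * (24 * real n * (25 / 36) + real K * real (F * Y))"
      using F0 Y0 ln2_le_25_over_36 ln_bound[of "real (F * Y)"]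
      by (intro mult_left_mono add_mono) auto
    also have "real K * real (F * Y) = real (K * (F * Y))" by simp
    also have "\<dots> \<le> real n" by (simp only: of_nat_le_iff) (simp add: n_def)
    finally show ?thesis by simp
  qed
  have card_P: "real N / 144 \<le> real n * real (card P)"
    unfolding P_def
  proof (rule card_primes_between_ge[OF n0 _ WN lnN])
    show "even N" using n0 by (simp add: N_def W_def)
    have "N0 \<le> n" by (simp add: n_def)
    also have "\<dots> \<le> 2 ^ n" using n2 by simp
    also have "\<dots> \<le> R" unfolding R_def by (intro power_increasing) auto
    finally show "B \<le> 2 * 2 ^ (3 * n)" by (simp add: B_def R_def)
  qed
  have W1: "768 * (s * 2 ^ n) ^ 12 \<le> W"
  proof -
    have "768 * (s * 2 ^ n) ^ 12 = 768 * s ^ 12 * 2 ^ (12 * n)"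
      by (simp add: power_mult_distrib mult.commute flip: power_mult)
    also have "\<dots> \<le> 2 ^ n * 2 ^ (12 * n)" using C_n by (intro mult_le_mono1)
    also have "\<dots> \<le> W" unfolding W_def power_add[symmetric] by (intro power_increasing) auto
    finally show ?thesis .
  qed
  have W2: "524288 * (s * 2 ^ n) ^ 24 * (F ^ K)\<^sup>2 * R\<^sup>2 < W\<^sup>2"
  proof -
    have "524288 * (s * 2 ^ n) ^ 24 * (F ^ K)\<^sup>2 * R\<^sup>2 = 524288 * s ^ 24 * (F ^ K)\<^sup>2 * 2 ^ (30 * n)"
      by (simp add: R_def power_mult_distrib power_mult[symmetric] power_add[symmetric] mult_ac)
    also have "\<dots> < 2 ^ n * 2 ^ (30 * n)" using C_n by (intro mult_strict_right_mono) auto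
    also have "\<dots> \<le> W\<^sup>2" unfolding W_def power_add[symmetric] power_mult[symmetric] by (intro power_increasing) auto
    finally show ?thesis .
  qed
  have QV_le: "(Q i * V i)\<^sup>2 \<le> N" if "i \<in> {1..K}" for i
  proof -
    have "F ^ i * Y ^ (K - i) \<le> F ^ K * Y ^ K"
      using that F0 Y0 by (intro mult_le_mono power_increasing) auto
    then have "Q i * V i \<le> W * (F * Y) ^ K" by (simp add: Q_def V_def power_mult_distrib mult_ac)
    then show ?thesis unfolding N_def by (intro power_mono) auto
  qed
  have bound: "real K * real (card P) / (32 * real N) \<le>
    16 * (real s)\<^sup>2 / ln (real R + 1) + real K * (128 / (real s * ln (real R + 1)) + 1 / real (s * 2 ^ n) ^ 3)"
  proof (rule prime_density_bound_of_no_square_differences[where L = L and Q = Q and V = V and W = W and M = "(F ^ K)\<^sup>2"])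
    show "p dvd L" if "prime p" "p \<le> R" for p
    proof -
      have "R \<le> 2 ^ (48 * n)" unfolding R_def by (intro power_increasing) auto
      then have "p \<le> 2 * N + 1" using that WN by linarith
      then show ?thesis unfolding L_def using that prime_ge_1_nat by (intro dvd_fact) auto
    qed
    show "p \<le> (4 * s\<^sup>2) ^ 3" if "i \<in> {1..K}" "prime p" "p dvd Q i" for i p
    proof -
      have "p dvd F" using that prime_dvd_power unfolding Q_def by blast
      then show ?thesis using that(2) by (simp only: F_def prime_dvd_fact_iff)
    qed
    show "(Q i)\<^sup>2 \<le> (F ^ K)\<^sup>2" if "i \<in> {1..K}" for i
      unfolding Q_def using that F0 by (intro power_mono power_increasing) auto
    show "W \<le> V i" if "i \<in> {1..K}" for i using Y0 by (simp add: V_def)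
    show "768 * real (s * 2 ^ n) ^ 12 \<le> real W"
      using of_nat_mono[OF W1, where 'a = real] by simp
    show "524288 * real (s * 2 ^ n) ^ 24 * real ((F ^ K)\<^sup>2) * (real R)\<^sup>2 < (real W)\<^sup>2"
      using of_nat_less_iff[THEN iffD2, OF W2, where 'a1 = real] by simp
    show "0 \<le> sq_mean (Q i') (V i') \<alpha>"
      if "i \<in> {1..K}" "i' \<in> {1..K}" "i < i'" "sq_mean (Q i) (V i) \<alpha> \<le> - 1 / real s ^ 3" for i i' \<alpha>
    proof -
      have "768 * s ^ 12 \<le> 768 * (s * 2 ^ n) ^ 12" by (intro mult_le_mono2 power_mono) auto
      then have "768 * s ^ 12 \<le> W" using W1 by linarith
      then have "768 * real s ^ 12 \<le> real W" using of_nat_mono[of "768 * s ^ 12" W, where 'a = real] by simp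
      then show ?thesis
        using sq_mean_nonneg_of_earlier_neg[OF s0 F0 F_dvd, of i i' K W \<alpha>] that
        unfolding Q_def V_def Y_def by simp
    qed
    show "\<not> int L dvd int p - int q + int ((Q i * v)\<^sup>2)"
      if "p \<in> P" "q \<in> P" "i \<in> {1..K}" "v \<in> {1..V i}" for p q i v
    proof
      assume d: "int L dvd int p - int q + int ((Q i * v)\<^sup>2)"
      have "(Q i * v)\<^sup>2 \<le> (Q i * V i)\<^sup>2" using that(4) by (intro power_mono mult_left_mono) auto
      then have QvN: "(Q i * v)\<^sup>2 \<le> N" using QV_le[OF that(3)] by linarith
      have "\<bar>int p - int q + int ((Q i * v)\<^sup>2)\<bar> < int L" 
      proof -
        have "int ((Q i * v)\<^sup>2) \<le> int N" using QvN by (rule of_nat_mono)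
        moreover have "int p \<le> int N" "int q \<le> int N" using that(1,2) by (auto simp: P_def)
        moreover have "2 * int N < int L" using L_gt by linarith
        ultimately show ?thesis by linarith
      qed
      then have "int p - int q + int ((Q i * v)\<^sup>2) = 0"
        using d zdvd_not_zless[of "\<bar>int p - int q + int ((Q i * v)\<^sup>2)\<bar>" "int L"] by auto
      then have eq: "int q - int p = (int (Q i * v)) ^ 2" by simp
      have "Q i * v > 0" using that(4) F0 by (simp add: Q_def)
      then have u: "int (Q i * v) \<ge> 1" by linarith
      then have "0 < int (Q i * v) ^ 2" by (intro zero_less_power) linarith
      then have "q \<noteq> p" using eq by auto
      moreover have "\<exists>u :: int. u \<ge> 1 \<and> int q - int p = u ^ 2" using u eq by blast
      ultimately have "(q, p) \<in> ?D" using that(1,2) unfolding P_def by blast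
      then have "q \<in> fst ` ?D" by (rule image_eqI[rotated]) simp
      then have "q \<le> N0" by (rule N0)
      \<comment> \<open>Elements of \<open>P\<close> exceed \<open>B\<close>, hence
        \<open>N0\<close>.\<close>
      then show False using that(2) by (auto simp: P_def B_def)
    qed
    show "P \<noteq> {}"
    proof
      assume "P = {}"
      then show False using card_P Npos by simp
    qed
    show "L > 0" "N < L" using L_gt by linarith+
    show "finite P" "P \<subseteq> {..N}" by (auto simp: P_def)
    show "prime p \<and> R < p" if "p \<in> P" for p using that by (simp add: P_def B_def)
  qed (fact s0 K0 Npos R0 QV_le)+
  define lam where "lam = ln (real R + 1)"
  have lam: "2 * real n \<le> lam"
  proof -
    have "2 * real n \<le> 3 * real n * ln 2" using ln2_ge_two_thirds n0 by simp
    also have "\<dots> = ln (real R)" by (simp add: R_def ln_realpow)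
    also have "\<dots> \<le> lam" unfolding lam_def using R0 by simp
    finally show ?thesis .
  qed
  then have lam0: "lam > 0" using n0 by simp
  have Kr: "real K = 8 * real s ^ 3" by (simp add: K_def)
  \<comment> \<open>After division by \<open>K\<close> both sides are of order \<open>1 / n\<close>,
    since \<open>lam \<ge> 2 * n\<close> and \<open>card P\<close> is at least
    \<open>N / (144 * n)\<close>. Multiplying by \<open>n\<close> then compares constants, and the
    right one tends to 0 with growing \<open>s\<close>.\<close>
  have "real K * (real (card P) / (32 * real N)) \<le>
      real K * (2 / (real s * lam) + 128 / (real s * lam) + 1 / real (s * 2 ^ n) ^ 3)"
  proof -
    have "16 * (real s)\<^sup>2 / lam = real K * (2 / (real s * lam))"
      using s0 lam0 by (simp add: Kr power3_eq_cube power2_eq_square)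
    then show ?thesis using bound unfolding lam_def[symmetric] by (simp add: distrib_left)
  qed
  then have "real (card P) / (32 * real N) \<le> 2 / (real s * lam) + 128 / (real s * lam) + 1 / real (s * 2 ^ n) ^ 3"
    by (rule mult_left_le_imp_le) (use K0 in simp)
  then have "real n * (real (card P) / (32 * real N)) \<le>
      real n * (2 / (real s * lam) + 128 / (real s * lam) + 1 / real (s * 2 ^ n) ^ 3)"
    by (rule mult_left_mono) simp
  also have "\<dots> = 130 / real s * (real n / lam) + real n / real (s * 2 ^ n) ^ 3"
    using s0 lam0 by (simp add: field_simps)
  also have "\<dots> \<le> 130 / real s * (1 / 2) + 1 / real s"
  proof (intro add_mono mult_left_mono)
    show "real n / lam \<le> 1 / 2" using lam lam0 by (simp add: field_simps)
    \<comment> \<open>The dyadic remainder is made small by the number \<open>n\<close> of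
      levels.\<close>
    have "n * s \<le> 2 ^ n * s" using n2 by (intro mult_le_mono1) simp
    also have "\<dots> \<le> (s * 2 ^ n) ^ 3" using s0 by (simp add: mult.commute self_le_power)
    finally have "real (n * s) \<le> real ((s * 2 ^ n) ^ 3)" by (simp only: of_nat_le_iff)
    then show "real n / real (s * 2 ^ n) ^ 3 \<le> 1 / real s" using s0 by (simp add: field_simps)
  qed simp
  also have "\<dots> = 66 / real s" by simp
  also have "\<dots> \<le> 66 / 1000000" using s s0 by (intro divide_left_mono) auto
  finally have "real n * real (card P) / (32 * real N) \<le> 66 / 1000000" by simp
  moreover have "real N / 144 / (32 * real N) \<le> real n * real (card P) / (32 * real N)"
    using card_P by (rule divide_right_mono) simp
  moreover have "real N / 144 / (32 * real N) = 1 / 4608" using Npos by simp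
  ultimately show False by linarith
qed

end
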